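(* Given a parallel transport $I$ along paths in a bundle $(E,\pi,M)$, there exists a unique connection $\Delta^h$ on $(E,\pi,M)$ such that the parallel transport $P$ along paths assigned to $\Delta^h$ coincides with $I$, $P=I$. Besides, the connection $\Delta^I$ generated by $I$ is identical with $\Delta^h$, $\Delta^I=\Delta^h$.
   Context: $\mathbb K=\mathbb R$ or $\mathbb C$. $(E,\pi,M)$ is a bundle with projection $\pi\colon E\to M$; $M$ and $E$ are $C^1$ manifolds over $\mathbb K$ of finite dimensions $n\ge 1$ and $n+r$, $r\ge 1$. $J$ denotes an arbitrary real interval, $[\sigma,\tau]$ a closed one. Paths are $C^1$ maps from real intervals (one-sided derivatives at closed endpoints; intervals nondegenerate wherever a tangent vector is taken). Transport along paths: a map $I$ assigning to every path $\gamma\colon J\to M$ maps $I^\gamma_{s\to t}\colon\pi^{-1}(\gamma(s))\to\pi^{-1}(\gamma(t))$, $s,t\in J$, with $I^\gamma_{s\to t}\circ I^\gamma_{r\to s}=I^\gamma_{r\to t}$ and $I^\gamma_{s\to s}=\mathrm{id}$. Put $\bar\gamma_{s_0,p}(t)=I^\gamma_{s_0\to t}(p)$ for $s_0\in J$, $p\in\pi^{-1}(\gamma(s_0))$. A parallel transport along paths is a transport along paths such that: (a) $\bar\gamma_{s_0,p}$ is $C^1$ for every $C^1$ path $\gamma$, $s_0$ and $p$; (b) if $\gamma_i\colon J_i\to M$, $i=1,2$, are $C^1$ with $\gamma_1(s_1)=\gamma_2(s_2)$ and $\dot\gamma_1(s_1)=\dot\gamma_2(s_2)$ for some $s_i\in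 J_i$, then $\dot{\bar\gamma}_{1;s_1,p}(s_1)=\dot{\bar\gamma}_{2;s_2,p}(s_2)$ for $p\in\pi^{-1}(\gamma_1(s_1))$, where $\bar\gamma_{i;s_i,p}(t)=I^{\gamma_i}_{s_i\to t}(p)$; (c) if $\gamma_i\colon J_i\to M$, $i=1,2$, are $C^1$ with $\gamma_1(s_1)=\gamma_2(s_2)$, then for every $a_1,a_2\in\mathbb K$ there is a $C^1$ path $\gamma_3\colon J_3\to M$ with $\gamma_3(s_3)=\gamma_1(s_1)$ for some $s_3\in J_3$ and $\dot{\bar\gamma}_{3;s_3,p}(s_3)=a_1\dot{\bar\gamma}_{1;s_1,p}(s_1)+a_2\dot{\bar\gamma}_{2;s_2,p}(s_2)$ for $p\in\pi^{-1}(\gamma_3(s_3))$. Connection: an $n$-dimensional distribution $\Delta^h\colon p\mapsto\Delta^h_p\subseteq T_p(E)$ on $E$ with $\Delta^v_p\oplus\Delta^h_p=T_p(E)$ for all $p\in E$, where $\Delta^v_p=T_p(\pi^{-1}(\pi(p)))$. The connection $\Delta^I$ generated by a parallel transport $I$ along paths is $\Delta^I_p=\{\frac{d}{dt}|_{t=s_0}\bar\gamma_{s_0,p}(t):\gamma\colon J\to M\ C^1\text{ and injective},\ s_0\in J,\ \gamma(s_0)=\pi(p)\}$. A horizontal lift of a $C^1$ path $\gamma\colon J\to M$ is a $C^1$ path $\bar\gamma\colon J\to E$ with $\pi\circ\bar\gamma=\gamma$ and $\dot{\bar\gamma}(s)\in\Delta^h_{\bar\gamma(s)}$ for all $s$.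 Connections are such that for each $\gamma$, $s_0\in J$, $p\in\pi^{-1}(\gamma(s_0))$ there is a unique horizontal lift with value $p$ at $s_0$. The parallel transport $\mathsf P$ generated by $\Delta^h$ assigns to $\gamma\colon[\sigma,\tau]\to M$ the map $\mathsf P^\gamma\colon\pi^{-1}(\gamma(\sigma))\to\pi^{-1}(\gamma(\tau))$, $\mathsf P^\gamma(p)=\bar\gamma_p(\tau)$, where $\bar\gamma_p$ is the horizontal lift of $\gamma$ with $\bar\gamma_p(\sigma)=p$. The parallel transport $P$ along paths assigned to (generated by) $\Delta^h$ is, for $\gamma\colon J\to M$ and $s,t\in J$: $P^\gamma_{s\to t}=\mathsf P^{\gamma|[s,t]}$ if $s\le t$, and $P^\gamma_{s\to t}=(\mathsf P^{\gamma|[t,s]})^{-1}$ if $s\ge t$, where $\mathsf P$ is the parallel transport generated by $\Delta^h$.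
   Formalization: It is additionally assumed that a path has at most one horizontal lift through a given point with respect to Δ^I; without this the claim fails (e.g. y moved to (y^{1/3}+γ(t)−γ(s))³ on ℝ²→ℝ), and it is necessary whenever the claim holds. *)

theory Defs
  imports "HOL-Analysis.Analysis" "HOL-Library.Function_Algebras"
begin

text \<open>
  The field \<open>\<bbbK>\<close> is a type \<open>'k\<close> of sort \<open>{real_normed_field, euclidean_space}\<close>: a commutative
  finite-dimensional real normed field, with \<^typ>\<open>real\<close> and \<^typ>\<open>complex\<close> as instances (and, up to
  isomorphism, nothing else).  The model space of an \<open>n\<close>-dimensional manifold over \<open>\<bbbK>\<close> is
  \<open>'k ^ 'n\<close> with \<open>n = CARD('n)\<close>; scalar multiplication over \<open>\<bbbK>\<close> is \<open>*s\<close>.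
\<close>

type_synonym ('a, 'k, 'n) chart = "'a set \<times> ('a \<Rightarrow> 'k ^ 'n)"
type_synonym ('a, 'k, 'n) tvec = "('a, 'k, 'n) chart \<Rightarrow> 'k ^ 'n"
type_synonym ('m, 'e) ptransport = "real set \<Rightarrow> (real \<Rightarrow> 'm) \<Rightarrow> real \<Rightarrow> real \<Rightarrow> 'e \<Rightarrow> 'e"

section \<open>Manifolds of class \<open>C\<^sup>1\<close> over \<open>\<bbbK>\<close>\<close>

text \<open>Class \<open>C\<^sup>1\<close> over \<open>\<bbbK>\<close>: the derivatives have to be \<open>\<bbbK>\<close>-linear (for complex \<open>\<bbbK>\<close>, the map is holomorphic).\<close>

definition C1_on ::
  "('k :: {real_normed_field, euclidean_space} ^ 'm) set \<Rightarrow> ('k ^ 'm \<Rightarrow> 'k ^ 'n) \<Rightarrow> bool" where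
  "C1_on S f \<longleftrightarrow> (\<exists>f'. continuous_on S f' \<and>
     (\<forall>x\<in>S. (f has_derivative blinfun_apply (f' x)) (at x) \<and>
            Vector_Spaces.linear (*s) (*s) (blinfun_apply (f' x))))"

text \<open>
  The manifold is the whole Hausdorff type \<open>'a\<close> with an atlas \<open>A\<close>, which need not be maximal.
  Conventions on second countability differ; it is not required.
\<close>

definition C1_manifold ::
  "('a :: t2_space, 'k :: {real_normed_field, euclidean_space}, 'n :: finite) chart set \<Rightarrow> bool" where
  "C1_manifold A \<longleftrightarrow>
     (\<Union>(U, \<phi>)\<in>A. U) = UNIV \<and>
     (\<forall>(U, \<phi>)\<in>A. open U \<and> open (\<phi> ` U) \<and> homeomorphism U (\<phi> ` U) \<phi> (inv_into U \<phi>)) \<and>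
     (\<forall>(U, \<phi>)\<in>A. \<forall>(V, \<psi>)\<in>A. C1_on (\<phi> ` (U \<inter> V)) (\<psi> \<circ> inv_into U \<phi>))"

definition C1_map ::
  "('a :: t2_space, 'k :: {real_normed_field, euclidean_space}, 'n :: finite) chart set \<Rightarrow>
   ('b :: t2_space, 'k, 'm :: finite) chart set \<Rightarrow> ('a \<Rightarrow> 'b) \<Rightarrow> bool" where
  "C1_map A B f \<longleftrightarrow> continuous_on UNIV f \<and>
     (\<forall>(U, \<phi>)\<in>A. \<forall>(V, \<psi>)\<in>B. C1_on (\<phi> ` (U \<inter> f -` V)) (\<psi> \<circ> f \<circ> inv_into U \<phi>))"

text \<open>
  A tangent vector at \<open>p\<close> is the family of its coordinate vectors in the charts around \<open>p\<close>, which
  transform by the derivatives of the coordinate changes; entries at other charts are \<open>0\<close>.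
\<close>

definition tspace ::
  "('a :: t2_space, 'k :: {real_normed_field, euclidean_space}, 'n :: finite) chart set \<Rightarrow> 'a \<Rightarrow>
   ('a, 'k, 'n) tvec set" where
  "tspace A p = {\<xi>.
     (\<forall>U \<phi>. \<not> ((U, \<phi>) \<in> A \<and> p \<in> U) \<longrightarrow> \<xi> (U, \<phi>) = 0) \<and>
     (\<forall>(U, \<phi>)\<in>A. \<forall>(V, \<psi>)\<in>A. p \<in> U \<inter> V \<longrightarrow>
        \<xi> (V, \<psi>) = frechet_derivative (\<psi> \<circ> inv_into U \<phi>) (at (\<phi> p)) (\<xi> (U, \<phi>)))}"

definition tscale :: "'k :: field \<Rightarrow> ('c \<Rightarrow> 'k ^ 'n) \<Rightarrow> ('c \<Rightarrow> 'k ^ 'n)" where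
  "tscale a \<xi> = (\<lambda>c. a *s \<xi> c)"

global_interpretation tvs: vector_space tscale
  by unfold_locales (auto simp: tscale_def fun_eq_iff vec.scale_right_distrib vec.scale_left_distrib)

section \<open>Paths\<close>

definition nondegenerate :: "real set \<Rightarrow> bool" where
  "nondegenerate J \<longleftrightarrow> (\<exists>s\<in>J. \<exists>t\<in>J. s \<noteq> t)"

text \<open>
  A path \<open>\<gamma>: J \<rightarrow> M\<close> is a pair of \<open>J\<close> and a function that is \<^const>\<open>undefined\<close> outside \<open>J\<close>, so that
  equality of functions is equality of paths.  Derivatives are taken within \<open>J\<close>, hence
  are one-sided at end points; a one-point interval is allowed, and there the
  differentiability condition holds trivially.
\<close>

definition C1_path ::
  "('a :: t2_space, 'k :: {real_normed_field, euclidean_space}, 'n :: finite) chart set \<Rightarrow>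
   real set \<Rightarrow> (real \<Rightarrow> 'a) \<Rightarrow> bool" where
  "C1_path A J \<gamma> \<longleftrightarrow> is_interval J \<and> J \<noteq> {} \<and> \<gamma> \<in> extensional J \<and> continuous_on J \<gamma> \<and>
     (\<forall>(U, \<phi>)\<in>A. \<exists>D. continuous_on (J \<inter> \<gamma> -` U) D \<and>
        (\<forall>t \<in> J \<inter> \<gamma> -` U. (\<phi> \<circ> \<gamma> has_vector_derivative D t) (at t within J)))"

definition velocity ::
  "('a :: t2_space, 'k :: {real_normed_field, euclidean_space}, 'n :: finite) chart set \<Rightarrow>
   real set \<Rightarrow> (real \<Rightarrow> 'a) \<Rightarrow> real \<Rightarrow> ('a, 'k, 'n) tvec" where
  "velocity A J \<gamma> t = (\<lambda>(U, \<phi>).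
     if (U, \<phi>) \<in> A \<and> \<gamma> t \<in> U then vector_derivative (\<phi> \<circ> \<gamma>) (at t within J) else 0)"

section \<open>Bundles and parallel transports along paths\<close>

text \<open>
  Of a bundle only a surjective \<open>C\<^sup>1\<close> projection is required, so that fibred manifolds and
  locally trivial bundles are covered.  The index type \<open>'n + 'r\<close> expresses
  \<open>dim E = n + r\<close>, where \<open>n, r \<ge> 1\<close> because types are inhabited.
\<close>

definition C1_bundle ::
  "('m :: t2_space, 'k :: {real_normed_field, euclidean_space}, 'n :: finite) chart set \<Rightarrow>
   ('e :: t2_space, 'k, 'n + 'r :: finite) chart set \<Rightarrow> ('e \<Rightarrow> 'm) \<Rightarrow> bool" where
  "C1_bundle A B \<pi> \<longleftrightarrow> C1_manifold A \<and> C1_manifold B \<and> C1_map B A \<pi> \<and> surj \<pi>"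

definition transport_along_paths ::
  "('m :: t2_space, 'k :: {real_normed_field, euclidean_space}, 'n :: finite) chart set \<Rightarrow>
   ('e \<Rightarrow> 'm) \<Rightarrow> ('m, 'e) ptransport \<Rightarrow> bool" where
  "transport_along_paths A \<pi> I \<longleftrightarrow>
     (\<forall>J \<gamma>. C1_path A J \<gamma> \<longrightarrow>
        (\<forall>s\<in>J. \<forall>t\<in>J. \<forall>p \<in> \<pi> -` {\<gamma> s}. I J \<gamma> s t p \<in> \<pi> -` {\<gamma> t}) \<and>
        (\<forall>r\<in>J. \<forall>s\<in>J. \<forall>t\<in>J. \<forall>p \<in> \<pi> -` {\<gamma> r}. I J \<gamma> s t (I J \<gamma> r s p) = I J \<gamma> r t p) \<and>
        (\<forall>s\<in>J. \<forall>p \<in> \<pi> -` {\<gamma> s}. I J \<gamma> s s p = p))"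

definition transport_lift :: "('m, 'e) ptransport \<Rightarrow> real set \<Rightarrow> (real \<Rightarrow> 'm) \<Rightarrow> real \<Rightarrow> 'e \<Rightarrow> real \<Rightarrow> 'e" where
  "transport_lift I J \<gamma> s p = restrict (\<lambda>t. I J \<gamma> s t p) J"

definition parallel_transport_along_paths ::
  "('m :: t2_space, 'k :: {real_normed_field, euclidean_space}, 'n :: finite) chart set \<Rightarrow>
   ('e :: t2_space, 'k, 'n + 'r :: finite) chart set \<Rightarrow> ('e \<Rightarrow> 'm) \<Rightarrow> ('m, 'e) ptransport \<Rightarrow> bool" where
  "parallel_transport_along_paths A B \<pi> I \<longleftrightarrow>
     transport_along_paths A \<pi> I \<and>
     (\<forall>J \<gamma>. C1_path A J \<gamma> \<longrightarrow>
        (\<forall>s\<in>J. \<forall>p \<in> \<pi> -` {\<gamma> s}. C1_path B J (transport_lift I J \<gamma> s p))) \<and>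
     (\<forall>J1 \<gamma>1 s1 J2 \<gamma>2 s2.
        C1_path A J1 \<gamma>1 \<and> nondegenerate J1 \<and> s1 \<in> J1 \<and>
        C1_path A J2 \<gamma>2 \<and> nondegenerate J2 \<and> s2 \<in> J2 \<and>
        \<gamma>1 s1 = \<gamma>2 s2 \<and> velocity A J1 \<gamma>1 s1 = velocity A J2 \<gamma>2 s2 \<longrightarrow>
        (\<forall>p \<in> \<pi> -` {\<gamma>1 s1}.
           velocity B J1 (transport_lift I J1 \<gamma>1 s1 p) s1 =
           velocity B J2 (transport_lift I J2 \<gamma>2 s2 p) s2)) \<and>
     (\<forall>J1 \<gamma>1 s1 J2 \<gamma>2 s2.
        C1_path A J1 \<gamma>1 \<and> nondegenerate J1 \<and> s1 \<in> J1 \<and>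
        C1_path A J2 \<gamma>2 \<and> nondegenerate J2 \<and> s2 \<in> J2 \<and> \<gamma>1 s1 = \<gamma>2 s2 \<longrightarrow>
        (\<forall>a1 a2. \<exists>J3 \<gamma>3 s3.
           C1_path A J3 \<gamma>3 \<and> nondegenerate J3 \<and> s3 \<in> J3 \<and> \<gamma>3 s3 = \<gamma>1 s1 \<and>
           (\<forall>p \<in> \<pi> -` {\<gamma>3 s3}.
              velocity B J3 (transport_lift I J3 \<gamma>3 s3 p) s3 =
              tscale a1 (velocity B J1 (transport_lift I J1 \<gamma>1 s1 p) s1) +
              tscale a2 (velocity B J2 (transport_lift I J2 \<gamma>2 s2 p) s2))))"

section \<open>Connections\<close>

text \<open>
  The tangent space of the fibre through \<open>p\<close> as a subspace of \<open>T\<^sub>p(E)\<close>: the velocities at \<open>p\<close> of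
  \<open>C\<^sup>1\<close> paths that stay in the fibre.  (Where \<open>\<pi>\<close> is a submersion - in particular whenever a
  parallel transport along paths exists - the fibres are submanifolds of dimension \<open>r\<close>.)
\<close>

definition vertical ::
  "('e :: t2_space, 'k :: {real_normed_field, euclidean_space}, 'd :: finite) chart set \<Rightarrow>
   ('e \<Rightarrow> 'm) \<Rightarrow> 'e \<Rightarrow> ('e, 'k, 'd) tvec set" where
  "vertical B \<pi> p = {velocity B J g s | J g s.
     C1_path B J g \<and> nondegenerate J \<and> s \<in> J \<and> g s = p \<and> (\<forall>t\<in>J. \<pi> (g t) = \<pi> p)}"

definition horizontal_distribution ::
  "('m :: t2_space, 'k :: {real_normed_field, euclidean_space}, 'n :: finite) chart set \<Rightarrow>
   ('e :: t2_space, 'k, 'n + 'r :: finite) chart set \<Rightarrow> ('e \<Rightarrow> 'm) \<Rightarrow>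
   ('e \<Rightarrow> ('e, 'k, 'n + 'r) tvec set) \<Rightarrow> bool" where
  "horizontal_distribution A B \<pi> \<Delta> \<longleftrightarrow> (\<forall>p.
     tvs.subspace (\<Delta> p) \<and> \<Delta> p \<subseteq> tspace B p \<and> tvs.dim (\<Delta> p) = CARD('n) \<and>
     {v + h | v h. v \<in> vertical B \<pi> p \<and> h \<in> \<Delta> p} = tspace B p \<and>
     vertical B \<pi> p \<inter> \<Delta> p = {0})"

definition horizontal_lift ::
  "('e :: t2_space, 'k :: {real_normed_field, euclidean_space}, 'd :: finite) chart set \<Rightarrow>
   ('e \<Rightarrow> 'm) \<Rightarrow> ('e \<Rightarrow> ('e, 'k, 'd) tvec set) \<Rightarrow>
   real set \<Rightarrow> (real \<Rightarrow> 'm) \<Rightarrow> (real \<Rightarrow> 'e) \<Rightarrow> bool" where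
  "horizontal_lift B \<pi> \<Delta> J \<gamma> g \<longleftrightarrow>
     C1_path B J g \<and> (\<forall>t\<in>J. \<pi> (g t) = \<gamma> t) \<and>
     (nondegenerate J \<longrightarrow> (\<forall>t\<in>J. velocity B J g t \<in> \<Delta> (g t)))"

definition connection ::
  "('m :: t2_space, 'k :: {real_normed_field, euclidean_space}, 'n :: finite) chart set \<Rightarrow>
   ('e :: t2_space, 'k, 'n + 'r :: finite) chart set \<Rightarrow> ('e \<Rightarrow> 'm) \<Rightarrow>
   ('e \<Rightarrow> ('e, 'k, 'n + 'r) tvec set) \<Rightarrow> bool" where
  "connection A B \<pi> \<Delta> \<longleftrightarrow> horizontal_distribution A B \<pi> \<Delta> \<and>
     (\<forall>J \<gamma>. C1_path A J \<gamma> \<longrightarrow> (\<forall>s\<in>J. \<forall>p \<in> \<pi> -` {\<gamma> s}.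
        \<exists>!g. horizontal_lift B \<pi> \<Delta> J \<gamma> g \<and> g s = p))"

text \<open>
  The uniqueness half of the lifting property in \<^const>\<open>connection\<close>, to be imposed on the connection
  generated by a parallel transport \<open>I\<close> along paths.  It does not follow from the axioms of \<open>I\<close>:
  on \<open>\<real>\<^sup>2 \<rightarrow> \<real>\<close>, \<open>(x, y) \<mapsto> x\<close>, let \<open>I\<close> move \<open>y\<close> along \<open>\<gamma>\<close> to \<open>(root 3 y + \<gamma> t - \<gamma> s) ^ 3\<close>; the
  generated distribution is spanned by \<open>(1, 3 (root 3 y)\<^sup>2)\<close>, and both \<open>t \<mapsto> (t, t ^ 3)\<close> and
  \<open>t \<mapsto> (t, 0)\<close> are horizontal.
\<close>

definition lifts_determined ::
  "('m :: t2_space, 'k :: {real_normed_field, euclidean_space}, 'n :: finite) chart set \<Rightarrow>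
   ('e :: t2_space, 'k, 'n + 'r :: finite) chart set \<Rightarrow> ('e \<Rightarrow> 'm) \<Rightarrow>
   ('e \<Rightarrow> ('e, 'k, 'n + 'r) tvec set) \<Rightarrow> bool" where
  "lifts_determined A B \<pi> \<Delta> \<longleftrightarrow>
     (\<forall>J \<gamma>. C1_path A J \<gamma> \<longrightarrow> (\<forall>s\<in>J. \<forall>p \<in> \<pi> -` {\<gamma> s}.
        \<exists>\<^sub>\<le>\<^sub>1g. horizontal_lift B \<pi> \<Delta> J \<gamma> g \<and> g s = p))"

definition generated_connection ::
  "('m :: t2_space, 'k :: {real_normed_field, euclidean_space}, 'n :: finite) chart set \<Rightarrow>
   ('e :: t2_space, 'k, 'n + 'r :: finite) chart set \<Rightarrow> ('e \<Rightarrow> 'm) \<Rightarrow> ('m, 'e) ptransport \<Rightarrow>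
   'e \<Rightarrow> ('e, 'k, 'n + 'r) tvec set" where
  "generated_connection A B \<pi> I p = {velocity B J (transport_lift I J \<gamma> s p) s | J \<gamma> s.
     C1_path A J \<gamma> \<and> nondegenerate J \<and> inj_on \<gamma> J \<and> s \<in> J \<and> \<gamma> s = \<pi> p}"

section \<open>Parallel transport assigned to a connection\<close>

definition parallel_transport ::
  "('e :: t2_space, 'k :: {real_normed_field, euclidean_space}, 'd :: finite) chart set \<Rightarrow>
   ('e \<Rightarrow> 'm) \<Rightarrow> ('e \<Rightarrow> ('e, 'k, 'd) tvec set) \<Rightarrow>
   real \<Rightarrow> real \<Rightarrow> (real \<Rightarrow> 'm) \<Rightarrow> 'e \<Rightarrow> 'e" where
  "parallel_transport B \<pi> \<Delta> \<sigma> \<tau> \<gamma> p =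
     (THE g. horizontal_lift B \<pi> \<Delta> {\<sigma>..\<tau>} \<gamma> g \<and> g \<sigma> = p) \<tau>"

definition assigned_transport ::
  "('e :: t2_space, 'k :: {real_normed_field, euclidean_space}, 'd :: finite) chart set \<Rightarrow>
   ('e \<Rightarrow> 'm) \<Rightarrow> ('e \<Rightarrow> ('e, 'k, 'd) tvec set) \<Rightarrow> ('m, 'e) ptransport" where
  "assigned_transport B \<pi> \<Delta> J \<gamma> s t =
     (if s \<le> t then parallel_transport B \<pi> \<Delta> s t (restrict \<gamma> {s..t})
      else inv_into (\<pi> -` {\<gamma> t}) (parallel_transport B \<pi> \<Delta> t s (restrict \<gamma> {t..s})))"

text \<open>Equality of transports: \<open>P\<^bsup>\<gamma>\<^esup>\<^bsub>s\<rightarrow>t\<^esub>\<close> and \<open>I\<^bsup>\<gamma>\<^esup>\<^bsub>s\<rightarrow>t\<^esub>\<close> are maps on the fibre over \<open>\<gamma>(s)\<close>.\<close>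

definition transports_coincide ::
  "('m :: t2_space, 'k :: {real_normed_field, euclidean_space}, 'n :: finite) chart set \<Rightarrow>
   ('e \<Rightarrow> 'm) \<Rightarrow> ('m, 'e) ptransport \<Rightarrow> ('m, 'e) ptransport \<Rightarrow> bool" where
  "transports_coincide A \<pi> P I \<longleftrightarrow>
     (\<forall>J \<gamma>. C1_path A J \<gamma> \<longrightarrow> (\<forall>s\<in>J. \<forall>t\<in>J. \<forall>p \<in> \<pi> -` {\<gamma> s}. P J \<gamma> s t p = I J \<gamma> s t p))"

end

theory Submission
  imports Defs
begin

text \<open>
  Assigning to the velocity of a path at \<open>\<pi> p\<close> the velocity of its lift at \<open>p\<close> is well defined by the axiom
  on equal velocities and \<open>\<bbbK>\<close>-linear by the axiom on linear combinations, because \<open>d\<pi>\<close> recovers the velocity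
  of the path from that of the lift.  It is thus a right inverse of \<open>d\<pi>\<close> at \<open>p\<close>, and its image \<open>\<Delta>\<^sup>I\<^sub>p\<close> is an
  \<open>n\<close>-dimensional complement of the kernel of \<open>d\<pi>\<close>.  In particular \<open>\<pi>\<close> is a submersion, so by the inverse
  function theorem this kernel consists of the velocities of paths in the fibre.  The lifts given by \<open>I\<close> are
  horizontal for \<open>\<Delta>\<^sup>I\<close>, and by uniqueness of horizontal lifts \<open>I\<close> is the assigned transport.  Conversely, if
  \<open>I\<close> is the transport assigned to \<open>\<Delta>\<close>, its lifts are the horizontal ones, so \<open>\<Delta>\<^sup>I\<^sub>p \<subseteq> \<Delta>\<^sub>p\<close>; both being
  complements of the vertical space, they agree.
\<close>

section \<open>Curves in level sets\<close>

text \<open>Being within 1/2 of the identity gives \<open>norm v \<le> 2 * norm (M t v)\<close> with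
  a constant independent of \<open>t\<close>. For \<open>v = x t - x s\<close> the right side is
  controlled by \<open>w - M t (x s)\<close>, which tends to 0 by continuity of \<open>M\<close>.
  This serves to make the velocity of a curve built from a local inverse continuous.\<close>

lemma continuous_on_blinfun_solution:
  fixes M :: "'c :: topological_space \<Rightarrow> 'a :: real_normed_vector \<Rightarrow>\<^sub>L 'a"
  assumes M: "continuous_on T M" and near: "\<And>t. t \<in> T \<Longrightarrow> dist (M t) id_blinfun \<le> 1/2"
    and x: "\<And>t. t \<in> T \<Longrightarrow> M t (x t) = w"
  shows "continuous_on T x"
  unfolding continuous_on_def
proof
  fix s assume s: "s \<in> T"
  have lower: "norm v \<le> 2 * norm (M t v)" if "t \<in> T" for t v
  proof -
    have "v = M t v - (M t - id_blinfun) v"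
      by (simp add: blinfun.diff_left)
    then have "norm v \<le> norm (M t v) + norm ((M t - id_blinfun) v)"
      by (metis norm_triangle_ineq4)
    also have "norm ((M t - id_blinfun) v) \<le> norm (M t - id_blinfun) * norm v"
      by (rule norm_blinfun)
    also have "\<dots> \<le> 1/2 * norm v"
      using near[OF that] by (intro mult_right_mono) (auto simp: dist_norm)
    finally show ?thesis by simp
  qed
  have "((\<lambda>t. M t (x s)) \<longlongrightarrow> M s (x s)) (at s within T)"
    using M s by (intro tendsto_intros) (auto simp: continuous_on_def)
  then have "((\<lambda>t. M t (x s) - w) \<longlongrightarrow> w - w) (at s within T)"
    using x[OF s] by (intro tendsto_intros) auto
  then have lim: "((\<lambda>t. 2 * norm (M t (x s) - w)) \<longlongrightarrow> 0) (at s within T)"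
    by (auto intro: tendsto_mult_right_zero tendsto_norm_zero)
  have "((\<lambda>t. x t - x s) \<longlongrightarrow> 0) (at s within T)"
  proof (rule Lim_null_comparison[OF _ lim])
    show "\<forall>\<^sub>F t in at s within T. norm (x t - x s) \<le> 2 * norm (M t (x s) - w)"
      using lower x by (auto simp: eventually_at_filter blinfun.diff_right norm_minus_commute
          intro!: always_eventually) (metis blinfun.diff_right norm_minus_commute)
  qed
  then show "(x \<longlongrightarrow> x s) (at s within T)"
    by (simp add: LIM_zero_iff)
qed

text \<open>
  If \<open>r\<close> is a right inverse of \<open>f' q\<close>, then \<open>F z = r (f z) + (z - q) - r (f' q (z - q))\<close> has the identity as
  derivative at \<open>q\<close>, and \<open>f' q (F z) = f z\<close>.  The local inverse of \<open>F\<close> thus maps a line in a direction of the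
  kernel into a level set of \<open>f\<close>.
\<close>

lemma level_set_curve:
  fixes f :: "'a :: euclidean_space \<Rightarrow> 'b :: euclidean_space"
  assumes S: "open S" "q \<in> S" and f': "continuous_on S f'"
    and der: "\<And>x. x \<in> S \<Longrightarrow> (f has_derivative blinfun_apply (f' x)) (at x)"
    and surj: "surj (blinfun_apply (f' q))" and w: "f' q w = 0"
  obtains \<epsilon> :: real and c c' where "0 < \<epsilon>" "c 0 = q" "c' 0 = w" "continuous_on {0..\<epsilon>} c'"
    "\<And>t. t \<in> {0..\<epsilon>} \<Longrightarrow> (c has_vector_derivative c' t) (at t within {0..\<epsilon>})"
    "\<And>t. t \<in> {0..\<epsilon>} \<Longrightarrow> c t \<in> S" "\<And>t. t \<in> {0..\<epsilon>} \<Longrightarrow> f (c t) = f q"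
proof -
  obtain r0 where r0: "linear r0" "blinfun_apply (f' q) \<circ> r0 = id"
    using linear_surjective_right_inverse[OF bounded_linear.linear[OF blinfun.bounded_linear_right] surj]
    by blast
  define r where "r = Blinfun r0"
  have fr: "f' q (r y) = y" for y
    using r0 linear_conv_bounded_linear[of r0] bounded_linear_Blinfun_apply[of r0]
    by (simp add: r_def fun_eq_iff)
  define F where "F z = r (f z) + (z - q) - r (f' q (z - q))" for z
  define F' where "F' z = (r o\<^sub>L f' z) + id_blinfun - (r o\<^sub>L f' q)" for z
  have fF: "f' q (F z) = f z" for z
    by (simp add: F_def blinfun.add_right blinfun.diff_right fr)
  have F'q: "F' q = id_blinfun" by (simp add: F'_def)
  have inv_F'q: "id_blinfun o\<^sub>L F' q = id_blinfun"
    by (rule blinfun_eqI) (simp add: F'q)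
  have derF: "(F has_derivative blinfun_apply (F' x)) (at x)" if "x \<in> S" for x
  proof -
    have "(F has_derivative (\<lambda>h. r (f' x h) + (h - 0) - r (f' q (h - 0)))) (at x)"
      unfolding F_def
      by (intro has_derivative_add has_derivative_diff has_derivative_ident has_derivative_const
          bounded_linear.has_derivative[OF blinfun.bounded_linear_right] der that)
    moreover have "(\<lambda>h. r (f' x h) + (h - 0) - r (f' q (h - 0))) = blinfun_apply (F' x)"
      by (simp add: F'_def fun_eq_iff blinfun.diff_left blinfun.add_left)
    ultimately show ?thesis by simp
  qed
  have contF': "continuous_on S F'"
    unfolding F'_def by (intro continuous_intros f')
  obtain U' V g g' where U': "open U'" "U' \<subseteq> S" "q \<in> U'" and V: "open V" "F q \<in> V"
    and hom: "homeomorphism U' V F g"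
    and g': "\<And>y. y \<in> V \<Longrightarrow> (g has_derivative (g' y)) (at y)"
      "\<And>y. y \<in> V \<Longrightarrow> g' y = inv (blinfun_apply (F'(g y)))"
    and bij: "\<And>y. y \<in> V \<Longrightarrow> bij (blinfun_apply (F'(g y)))"
    by (rule inverse_function_theorem[OF S(1) derF contF' S(2) inv_F'q]) (use that in blast)+
  \<comment> \<open>The line through \<open>F q\<close> in direction \<open>w\<close>. Since
    \<open>F' q\<close> is the identity, its image under the local inverse \<open>g\<close> starts
    at \<open>q\<close> with velocity \<open>w\<close>.\<close>
  define y where "y t = F q + t *\<^sub>R w" for t
  define c where "c t = g (y t)" for t
  define c' where "c' t = g' (y t) w" for t
  define W where "W = y -` V"
  have conty: "continuous_on X y" for X
    unfolding y_def by (intro continuous_intros)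
  have openW: "open W"
    unfolding W_def by (rule open_vimage[OF V(1) conty])
  have contc: "continuous_on W c"
    unfolding c_def
    by (rule continuous_on_compose2[OF homeomorphism_cont2[OF hom] conty]) (auto simp: W_def)
  have cS: "c t \<in> S" if "t \<in> W" for t
    using that homeomorphism_image2[OF hom] U'(2) by (auto simp: W_def c_def)
  have contM: "continuous_on W (\<lambda>t. F' (c t))"
    by (rule continuous_on_compose2[OF contF' contc]) (use cS in auto)
  have c0: "c 0 = q"
    using hom U'(3) by (simp add: c_def y_def homeomorphism_apply1)
  \<comment> \<open>The time interval is shrunk until \<open>F' (c t)\<close> stays within 1/2 of
    the identity, as \<open>continuous_on_blinfun_solution\<close> demands, while membership in
    \<open>W\<close> keeps the line inside the domain of \<open>g\<close>.\<close>
  have "open ((\<lambda>t. F' (c t)) -` ball id_blinfun (1/2) \<inter> W)"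
    using contM openW continuous_on_open_vimage by blast
  moreover have "0 \<in> (\<lambda>t. F' (c t)) -` ball id_blinfun (1/2) \<inter> W"
    using V(2) by (simp add: c0 F'q W_def y_def)
  ultimately obtain \<epsilon> where \<epsilon>: "0 < \<epsilon>" "cball 0 \<epsilon> \<subseteq> (\<lambda>t. F' (c t)) -` ball id_blinfun (1/2) \<inter> W"
    by (meson open_contains_cball)
  have sub: "t \<in> W" "dist (F' (c t)) id_blinfun \<le> 1/2" if "t \<in> {0..\<epsilon>}" for t
  proof -
    have "t \<in> cball 0 \<epsilon>" using that by simp
    then have "t \<in> W \<and> dist id_blinfun (F' (c t)) < 1/2"
      using \<epsilon>(2) unfolding subset_iff vimage_eq Int_iff mem_ball by blast
    then show "t \<in> W" "dist (F' (c t)) id_blinfun \<le> 1/2"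
      unfolding dist_commute[of _ id_blinfun] by linarith+
  qed
  show thesis
  proof
    show "0 < \<epsilon>" "c 0 = q" by fact+
    have "F q \<in> V" "g (F q) = q" using V c0 by (auto simp: c_def y_def)
    then show "c' 0 = w"
      using g'(2)[of "F q"] by (simp add: c'_def y_def F'q)
    show "continuous_on {0..\<epsilon>} c'"
    proof (rule continuous_on_blinfun_solution)
      show "continuous_on {0..\<epsilon>} (\<lambda>t. F' (c t))"
        using contM sub by (meson continuous_on_subset subsetI)
      show "F' (c t) (c' t) = w" if "t \<in> {0..\<epsilon>}" for t
        using sub(1)[OF that] bij[of "y t"] g'(2)[of "y t"]
        by (simp add: W_def c'_def c_def bij_is_surj surj_f_inv_f)
    qed (use sub in auto)
    show "(c has_vector_derivative c' t) (at t within {0..\<epsilon>})" if "t \<in> {0..\<epsilon>}" for t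
    proof -
      have "(y has_vector_derivative w) (at t within {0..\<epsilon>})"
        unfolding y_def by (auto intro!: derivative_eq_intros)
      moreover have "(g has_derivative g' (y t)) (at (y t) within y ` {0..\<epsilon>})"
        using sub(1)[OF that] g'(1) by (auto simp: W_def intro: has_derivative_at_withinI)
      ultimately show ?thesis
        using vector_derivative_diff_chain_within[of y w t "{0..\<epsilon>}" g "g' (y t)"]
        by (simp add: c_def[abs_def] c'_def comp_def)
    qed
    show "c t \<in> S" if "t \<in> {0..\<epsilon>}" for t
      using cS sub(1) that by blast
    show "f (c t) = f q" if "t \<in> {0..\<epsilon>}" for t
    proof -
      have "F (c t) = y t"
        using sub(1)[OF that] hom by (simp add: c_def W_def homeomorphism_apply2)
      \<comment> \<open>\<open>y t\<close> differs from \<open>F q\<close> by a multiple of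
        \<open>w\<close>, which \<open>f' q\<close> kills; \<open>fF\<close> turns both sides into
        values of \<open>f\<close>.\<close>
      then have "f' q (F (c t)) = f' q (F q)"
        using w by (simp add: y_def blinfun.add_right blinfun.scaleR_right)
      then show ?thesis by (simp add: fF)
    qed
  qed
qed

section \<open>Paths and velocities in charts\<close>

lemma C1_on_derivative:
  assumes "C1_on S f" "x \<in> S"
  shows "(f has_derivative frechet_derivative f (at x)) (at x)"
    and "Vector_Spaces.linear (*s) (*s) (frechet_derivative f (at x))"
  using assms frechet_derivative_at unfolding C1_on_def by metis+

text \<open>\<open>C1_on\<close> provides some continuous derivative \<open>f'\<close>. By
  uniqueness of derivatives it agrees on \<open>S\<close> with \<open>frechet_derivative\<close>,
  the form in which \<open>tspace\<close> expresses coordinate changes.\<close>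

lemma C1_on_continuous_derivative:
  assumes f: "C1_on S f" and c: "continuous_on T c" "c ` T \<subseteq> S" and d: "continuous_on T d"
  shows "continuous_on T (\<lambda>t. frechet_derivative f (at (c t)) (d t))"
proof -
  obtain f' where f': "continuous_on S f'"
    and der: "\<And>x. x \<in> S \<Longrightarrow> (f has_derivative blinfun_apply (f' x)) (at x)"
    using f unfolding C1_on_def by blast
  have "continuous_on T (\<lambda>t. f' (c t) (d t))"
    using c d by (intro continuous_intros continuous_on_compose2[OF f'])
  moreover have "blinfun_apply (f' (c t)) = frechet_derivative f (at (c t))" if "t \<in> T" for t
    using c that by (intro frechet_derivative_at der) blast
  ultimately show ?thesis
    by (simp cong: continuous_on_cong)
qed

lemma C1_manifold_chart:
  assumes "C1_manifold A" "(U, \<phi>) \<in> A"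
  shows "open U" "open (\<phi> ` U)" "homeomorphism U (\<phi> ` U) \<phi> (inv_into U \<phi>)"
  using assms unfolding C1_manifold_def by blast+

lemma inv_into_chart:
  assumes "C1_manifold A" "(U, \<phi>) \<in> A" "x \<in> U"
  shows "inv_into U \<phi> (\<phi> x) = x"
  using C1_manifold_chart(3)[OF assms(1,2)] assms(3) by (rule homeomorphism_apply1)

lemma chart_around:
  assumes "C1_manifold A"
  obtains U \<phi> where "(U, \<phi>) \<in> A" "x \<in> U"
proof -
  have "(\<Union>(U, \<phi>)\<in>A. U) = UNIV"
    using assms unfolding C1_manifold_def by (rule conjunct1)
  then have "x \<in> (\<Union>(U, \<phi>)\<in>A. U)" by simp
  then show ?thesis by (auto intro: that)
qed

text \<open>Coordinate changes are the chart expressions of the identity, so facts about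
  \<open>C1_map\<close> apply to them too.\<close>

lemma C1_map_id: "C1_manifold A \<Longrightarrow> C1_map A A id"
  unfolding C1_manifold_def C1_map_def by (fastforce simp: continuous_on_id)

lemma C1_map_chart:
  "C1_map A B f \<Longrightarrow> (U, \<phi>) \<in> A \<Longrightarrow> (V, \<psi>) \<in> B \<Longrightarrow> C1_on (\<phi> ` (U \<inter> f -` V)) (\<psi> \<circ> f \<circ> inv_into U \<phi>)"
  unfolding C1_map_def by blast

text \<open>Every point of such an interval is a limit point of it, which makes derivatives within
  \<open>J\<close> unique, also at end points.\<close>

lemma at_within_nondegenerate:
  assumes "is_interval J" "nondegenerate J" "t \<in> J"
  shows "at t within J \<noteq> bot"
proof -
  have "t islimpt J"
    using assms by (intro connected_imp_perfect) (auto simp: nondegenerate_def is_interval_connected)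
  then show ?thesis by (simp add: trivial_limit_within)
qed

lemma C1_path_interval:
  "C1_path A J \<gamma> \<Longrightarrow> is_interval J" "C1_path A J \<gamma> \<Longrightarrow> continuous_on J \<gamma>"
  "C1_path A J \<gamma> \<Longrightarrow> \<gamma> \<in> extensional J"
  by (simp_all add: C1_path_def)

lemma velocity_eqI:
  assumes "is_interval J" "nondegenerate J" "t \<in> J" "(U, \<phi>) \<in> A" "\<gamma> t \<in> U"
    and "(\<phi> \<circ> \<gamma> has_vector_derivative v) (at t within J)"
  shows "velocity A J \<gamma> t (U, \<phi>) = v"
  using assms vector_derivative_within[OF at_within_nondegenerate] by (simp add: velocity_def)

lemma C1_path_has_velocity:
  assumes "C1_path A J \<gamma>" "nondegenerate J" "t \<in> J" "(U, \<phi>) \<in> A" "\<gamma> t \<in> U"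
  shows "(\<phi> \<circ> \<gamma> has_vector_derivative velocity A J \<gamma> t (U, \<phi>)) (at t within J)"
proof -
  obtain v where "(\<phi> \<circ> \<gamma> has_vector_derivative v) (at t within J)"
    using assms unfolding C1_path_def by fast
  then show ?thesis
    using velocity_eqI[of J t U \<phi> A \<gamma> v] assms C1_path_interval(1) by metis
qed

text \<open>The chain rule in charts. Agreement of \<open>h\<close> with the image path is asked on
  \<open>J\<close> only, because derivatives are taken within \<open>J\<close> and paths carry no
  information outside it.\<close>

lemma velocity_C1_map:
  assumes A: "C1_manifold A" and f: "C1_map A B f"
    and g: "C1_path A J g" "nondegenerate J" "t \<in> J" and h: "\<And>s. s \<in> J \<Longrightarrow> h s = f (g s)"
    and U: "(U, \<phi>) \<in> A" "g t \<in> U" and V: "(V, \<psi>) \<in> B" "h t \<in> V"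
  shows "velocity B J h t (V, \<psi>) =
    frechet_derivative (\<psi> \<circ> f \<circ> inv_into U \<phi>) (at (\<phi> (g t))) (velocity A J g t (U, \<phi>))"
proof (rule velocity_eqI)
  let ?F = "\<psi> \<circ> f \<circ> inv_into U \<phi>"
  have "\<phi> (g t) \<in> \<phi> ` (U \<inter> f -` V)"
    using U V h g by auto
  from C1_on_derivative(1)[OF C1_map_chart[OF f U(1) V(1)] this]
  have "(?F has_derivative frechet_derivative ?F (at (\<phi> (g t)))) (at ((\<phi> \<circ> g) t))"
    unfolding comp_apply[of \<phi> g] .
  then have *: "(?F \<circ> (\<phi> \<circ> g) has_vector_derivative
      frechet_derivative ?F (at (\<phi> (g t))) (velocity A J g t (U, \<phi>))) (at t within J)"
    by (rule vector_derivative_diff_chain_within[OF C1_path_has_velocity[OF g U]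
          has_derivative_at_withinI])
  \<comment> \<open>The inverse chart cancels only while the path is in \<open>U\<close>; by
    continuity this holds near \<open>t\<close>, which suffices for the derivative.\<close>
  have "\<forall>\<^sub>F s in at t within J. g s \<in> U"
    using C1_path_interval(2)[OF g(1)] C1_manifold_chart(1)[OF A U(1)] g(3) U(2)
    by (auto simp: continuous_on_def intro: topological_tendstoD)
  then have "\<forall>\<^sub>F s in at t within J. (?F \<circ> (\<phi> \<circ> g)) s = (\<psi> \<circ> h) s"
    using inv_into_chart[OF A U(1)] h by (auto simp: eventually_at_filter elim!: eventually_mono)
  with * show "(\<psi> \<circ> h has_vector_derivative
      frechet_derivative ?F (at (\<phi> (g t))) (velocity A J g t (U, \<phi>))) (at t within J)"
    unfolding has_vector_derivative_def
    by (rule has_derivative_transform_eventually) (use inv_into_chart[OF A U] h g(3) in auto)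
qed (use g V C1_path_interval in auto)

section \<open>Tangent spaces and the velocities in them\<close>

lemma tspace_iff:
  "\<xi> \<in> tspace A p \<longleftrightarrow>
     (\<forall>U \<phi>. \<not> ((U, \<phi>) \<in> A \<and> p \<in> U) \<longrightarrow> \<xi> (U, \<phi>) = 0) \<and>
     (\<forall>U \<phi> V \<psi>. (U, \<phi>) \<in> A \<longrightarrow> p \<in> U \<longrightarrow> (V, \<psi>) \<in> A \<longrightarrow> p \<in> V \<longrightarrow>
        \<xi> (V, \<psi>) = frechet_derivative (\<psi> \<circ> inv_into U \<phi>) (at (\<phi> p)) (\<xi> (U, \<phi>)))"
  unfolding tspace_def by blast

text \<open>The chain rule for the identity, read in two charts, is exactly the transformation law
  of tangent vectors.\<close>

lemma velocity_in_tspace: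
  assumes A: "C1_manifold A" and \<gamma>: "C1_path A J \<gamma>" "nondegenerate J" "t \<in> J"
  shows "velocity A J \<gamma> t \<in> tspace A (\<gamma> t)"
  unfolding tspace_iff
proof (intro conjI allI impI)
  show "velocity A J \<gamma> t (U, \<phi>) = 0" if "\<not> ((U, \<phi>) \<in> A \<and> \<gamma> t \<in> U)" for U \<phi>
    using that by (auto simp: velocity_def)
  show "velocity A J \<gamma> t (V, \<psi>) =
      frechet_derivative (\<psi> \<circ> inv_into U \<phi>) (at (\<phi> (\<gamma> t))) (velocity A J \<gamma> t (U, \<phi>))"
    if "(U, \<phi>) \<in> A" "\<gamma> t \<in> U" "(V, \<psi>) \<in> A" "\<gamma> t \<in> V" for U \<phi> V \<psi>
    using velocity_C1_map[OF A C1_map_id[OF A] \<gamma>, of \<gamma> U \<phi> V \<psi>] that by simp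
qed

text \<open>The transformation law propagates the entry at one chart around \<open>p\<close> to all
  the others, and the remaining entries are 0. Tangent vectors can thus be compared in a single
  chart.\<close>

lemma tspace_eqI:
  assumes "\<xi> \<in> tspace A p" "\<eta> \<in> tspace A p" "(U, \<phi>) \<in> A" "p \<in> U" "\<xi> (U, \<phi>) = \<eta> (U, \<phi>)"
  shows "\<xi> = \<eta>"
proof
  show "\<xi> c = \<eta> c" for c
  proof (cases c)
    case c: (Pair V \<psi>)
    show ?thesis
    proof (cases "(V, \<psi>) \<in> A \<and> p \<in> V")
      case True
      then show ?thesis using assms unfolding tspace_iff c by metis
    next
      case False
      then show ?thesis using assms(1,2) unfolding tspace_iff c by metis
    qed
  qed
qed

lemma velocity_eq_chartI:
  assumes A: "C1_manifold A" and \<gamma>: "C1_path A J \<gamma>" "nondegenerate J" "s \<in> J"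
    and \<gamma>': "C1_path A J' \<gamma>'" "nondegenerate J'" "s' \<in> J'" and x: "\<gamma> s = x" "\<gamma>' s' = x"
    and U: "(U, \<phi>) \<in> A" "x \<in> U" and eq: "velocity A J \<gamma> s (U, \<phi>) = velocity A J' \<gamma>' s' (U, \<phi>)"
  shows "velocity A J \<gamma> s = velocity A J' \<gamma>' s'"
  by (rule tspace_eqI[of _ A x _ U \<phi>, OF velocity_in_tspace[OF A \<gamma>, unfolded x]
        velocity_in_tspace[OF A \<gamma>', unfolded x] U eq])

text \<open>The conditions defining \<open>tspace\<close> are linear over the field because
  \<open>C1_on\<close> makes the derivatives of coordinate changes linear over it.\<close>

lemma subspace_tspace:
  fixes A :: "('a :: t2_space, 'k :: {real_normed_field, euclidean_space}, 'n :: finite) chart set"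
  assumes A: "C1_manifold A"
  shows "tvs.subspace (tspace A p)"
proof -
  define D where "D = (\<lambda>U (\<phi> :: 'a \<Rightarrow> 'k ^ 'n) (\<psi> :: 'a \<Rightarrow> 'k ^ 'n).
    frechet_derivative (\<psi> \<circ> inv_into U \<phi>) (at (\<phi> p)))"
  have lin: "Vector_Spaces.linear (*s) (*s) (D U \<phi> \<psi>)"
    if "(U, \<phi>) \<in> A" "p \<in> U" "(V, \<psi>) \<in> A" "p \<in> V" for U V \<phi> \<psi>
    using C1_on_derivative(2)[OF C1_map_chart[OF C1_map_id[OF A] that(1,3)], of "\<phi> p"] that
    by (simp add: D_def)
  note lin = vec.linear_0[OF lin] vec.linear_add[OF lin] vec.linear_scale[OF lin]
  have iff: "\<xi> \<in> tspace A p \<longleftrightarrow>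
     (\<forall>U \<phi>. \<not> ((U, \<phi>) \<in> A \<and> p \<in> U) \<longrightarrow> \<xi> (U, \<phi>) = 0) \<and>
     (\<forall>U \<phi> V \<psi>. (U, \<phi>) \<in> A \<longrightarrow> p \<in> U \<longrightarrow> (V, \<psi>) \<in> A \<longrightarrow> p \<in> V \<longrightarrow>
        \<xi> (V, \<psi>) = D U \<phi> \<psi> (\<xi> (U, \<phi>)))" for \<xi>
    unfolding tspace_iff D_def ..
  show ?thesis
    unfolding tvs.subspace_def
  proof (intro conjI ballI allI)
    show "0 \<in> tspace A p"
      unfolding iff using lin(1) by (simp add: zero_fun_def)
    show "\<xi> + \<eta> \<in> tspace A p" if "\<xi> \<in> tspace A p" "\<eta> \<in> tspace A p" for \<xi> \<eta>
      unfolding iff plus_fun_apply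
    proof (intro conjI allI impI)
      show "\<xi> (U, \<phi>) + \<eta> (U, \<phi>) = 0" if "\<not> ((U, \<phi>) \<in> A \<and> p \<in> U)" for U \<phi>
        using that \<open>\<xi> \<in> _\<close> \<open>\<eta> \<in> _\<close> unfolding iff by (metis add.right_neutral)
      show "\<xi> (V, \<psi>) + \<eta> (V, \<psi>) = D U \<phi> \<psi> (\<xi> (U, \<phi>) + \<eta> (U, \<phi>))"
        if c: "(U, \<phi>) \<in> A" "p \<in> U" "(V, \<psi>) \<in> A" "p \<in> V" for U \<phi> V \<psi>
        using c \<open>\<xi> \<in> _\<close> \<open>\<eta> \<in> _\<close> unfolding iff lin(2)[OF c] by metis
    qed
    show "tscale a \<xi> \<in> tspace A p" if "\<xi> \<in> tspace A p" for a \<xi>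
      unfolding iff tscale_def
    proof (intro conjI allI impI)
      show "a *s \<xi> (U, \<phi>) = 0" if "\<not> ((U, \<phi>) \<in> A \<and> p \<in> U)" for U \<phi>
        using that \<open>\<xi> \<in> _\<close> unfolding iff by (metis vec.scale_zero_right)
      show "a *s \<xi> (V, \<psi>) = D U \<phi> \<psi> (a *s \<xi> (U, \<phi>))"
        if c: "(U, \<phi>) \<in> A" "p \<in> U" "(V, \<psi>) \<in> A" "p \<in> V" for U \<phi> V \<psi>
        using c \<open>\<xi> \<in> _\<close> unfolding iff lin(3)[OF c] by metis
    qed
  qed
qed

section \<open>Constructing and restricting paths\<close>

text \<open>A coordinate curve inside one chart is pulled back to the manifold. In any other chart
  it is the curve followed by a coordinate change, so its derivative there is continuous by
  \<open>C1_on_continuous_derivative\<close>.\<close>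

lemma chart_curve:
  fixes c :: "real \<Rightarrow> 'k :: {real_normed_field, euclidean_space} ^ 'n :: finite"
  assumes A: "C1_manifold A" and U: "(U, \<phi>) \<in> A" and J: "is_interval J" "nondegenerate J"
    and der: "\<forall>t\<in>J. (c has_vector_derivative c' t) (at t within J)" and c': "continuous_on J c'"
    and cU: "c ` J \<subseteq> \<phi> ` U"
  defines "\<gamma> \<equiv> restrict (inv_into U \<phi> \<circ> c) J"
  shows "C1_path A J \<gamma>" and "\<And>t. t \<in> J \<Longrightarrow> \<gamma> t \<in> U" and "\<And>t. t \<in> J \<Longrightarrow> \<phi> (\<gamma> t) = c t"
    and "\<And>t. t \<in> J \<Longrightarrow> velocity A J \<gamma> t (U, \<phi>) = c' t"
proof -
  note hom = C1_manifold_chart(3)[OF A U] and c = der[rule_format] c'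
  show \<gamma>U: "\<gamma> t \<in> U" if "t \<in> J" for t
    using cU that by (auto simp: \<gamma>_def inv_into_into)
  show \<phi>\<gamma>: "\<phi> (\<gamma> t) = c t" if "t \<in> J" for t
    using cU that by (auto simp: \<gamma>_def f_inv_into_f image_subset_iff)
  have contc: "continuous_on J c"
    using c(1) by (meson continuous_on_eq_continuous_within has_vector_derivative_continuous)
  have cont: "continuous_on J \<gamma>"
    unfolding \<gamma>_def
    using continuous_on_compose2[OF homeomorphism_cont2[OF hom] contc cU]
    by (simp add: comp_def cong: continuous_on_cong)
  have der_chart: "(\<psi> \<circ> \<gamma> has_vector_derivative
      frechet_derivative (\<psi> \<circ> inv_into U \<phi>) (at (c t)) (c' t)) (at t within J)"
    and mem: "c t \<in> \<phi> ` (U \<inter> V)"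
    if "(V, \<psi>) \<in> A" "t \<in> J" "\<gamma> t \<in> V" for V \<psi> t
  proof -
    show mem: "c t \<in> \<phi> ` (U \<inter> V)"
      unfolding \<phi>\<gamma>[OF that(2), symmetric] using \<gamma>U[OF that(2)] that(3) by (intro imageI IntI)
    have "((\<psi> \<circ> inv_into U \<phi>) \<circ> c has_vector_derivative
        frechet_derivative (\<psi> \<circ> inv_into U \<phi>) (at (c t)) (c' t)) (at t within J)"
    proof (rule vector_derivative_diff_chain_within[OF c(1)[OF that(2)]])
      have "C1_on (\<phi> ` (U \<inter> V)) (\<psi> \<circ> inv_into U \<phi>)"
        using C1_map_chart[OF C1_map_id[OF A] U that(1)] by simp
      from C1_on_derivative(1)[OF this mem]
      show "(\<psi> \<circ> inv_into U \<phi> has_derivative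
          frechet_derivative (\<psi> \<circ> inv_into U \<phi>) (at (c t))) (at (c t) within c ` J)"
        by (rule has_derivative_at_withinI)
    qed
    then show "(\<psi> \<circ> \<gamma> has_vector_derivative
        frechet_derivative (\<psi> \<circ> inv_into U \<phi>) (at (c t)) (c' t)) (at t within J)"
      by (rule has_vector_derivative_transform[rotated 2]) (use that in \<open>auto simp: \<gamma>_def\<close>)
  qed
  show path: "C1_path A J \<gamma>"
    unfolding C1_path_def
  proof (intro conjI J cont ballI)
    show "J \<noteq> {}" "\<gamma> \<in> extensional J"
      using J(2) by (auto simp: nondegenerate_def \<gamma>_def)
    fix chart assume "chart \<in> A"
    moreover obtain V \<psi> where "chart = (V, \<psi>)" by (cases chart)
    ultimately have V: "(V, \<psi>) \<in> A" "chart = (V, \<psi>)" by auto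
    have "continuous_on (J \<inter> \<gamma> -` V) (\<lambda>t. frechet_derivative (\<psi> \<circ> inv_into U \<phi>) (at (c t)) (c' t))"
    proof (rule C1_on_continuous_derivative)
      show "C1_on (\<phi> ` (U \<inter> V)) (\<psi> \<circ> inv_into U \<phi>)"
        using C1_map_chart[OF C1_map_id[OF A] U V(1)] by simp
      show "continuous_on (J \<inter> \<gamma> -` V) c" "continuous_on (J \<inter> \<gamma> -` V) c'"
        using contc c(2) continuous_on_subset by blast+
      show "c ` (J \<inter> \<gamma> -` V) \<subseteq> \<phi> ` (U \<inter> V)"
        using mem V by auto
    qed
    then show "case chart of (V, \<psi>) \<Rightarrow> \<exists>D. continuous_on (J \<inter> \<gamma> -` V) D \<and>
        (\<forall>t\<in>J \<inter> \<gamma> -` V. (\<psi> \<circ> \<gamma> has_vector_derivative D t) (at t within J))"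
      using der_chart V by auto
  qed
  show "velocity A J \<gamma> t (U, \<phi>) = c' t" if "t \<in> J" for t
  proof (rule velocity_eqI[of J t U \<phi> A \<gamma>])
    show "(\<phi> \<circ> \<gamma> has_vector_derivative c' t) (at t within J)"
      by (rule has_vector_derivative_transform[OF that _ c(1)[OF that]]) (simp add: \<phi>\<gamma>)
  qed (use J that U \<gamma>U in auto)
qed

lemma C1_path_restrict:
  assumes "C1_path A J \<gamma>" "is_interval J'" "J' \<noteq> {}" "J' \<subseteq> J"
  shows "C1_path A J' (restrict \<gamma> J')"
  unfolding C1_path_def
proof (intro conjI assms ballI)
  show "continuous_on J' (restrict \<gamma> J')"
    using assms continuous_on_subset[OF C1_path_interval(2)] by (simp cong: continuous_on_cong) blast
  fix chart assume *: "chart \<in> A"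
  obtain U \<phi> where U: "chart = (U, \<phi>)" by (cases chart)
  obtain D where D: "continuous_on (J \<inter> \<gamma> -` U) D"
    "\<And>t. t \<in> J \<inter> \<gamma> -` U \<Longrightarrow> (\<phi> \<circ> \<gamma> has_vector_derivative D t) (at t within J)"
    using assms(1) * unfolding C1_path_def U by fast
  have "(\<phi> \<circ> restrict \<gamma> J' has_vector_derivative D t) (at t within J')"
    if "t \<in> J' \<inter> restrict \<gamma> J' -` U" for t
    by (rule has_vector_derivative_transform[OF _ _ has_vector_derivative_within_subset[OF D(2)]])
       (use that assms in auto)
  moreover have "continuous_on (J' \<inter> restrict \<gamma> J' -` U) D"
    by (rule continuous_on_subset[OF D(1)]) (use assms in auto)
  ultimately show "case chart of (U, \<phi>) \<Rightarrow> \<exists>D. continuous_on (J' \<inter> restrict \<gamma> J' -` U) D \<and>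
      (\<forall>t\<in>J' \<inter> restrict \<gamma> J' -` U. (\<phi> \<circ> restrict \<gamma> J' has_vector_derivative D t) (at t within J'))"
    using U by auto
qed simp

lemma velocity_restrict:
  assumes "C1_path A J \<gamma>" "is_interval J'" "nondegenerate J'" "J' \<subseteq> J" "t \<in> J'"
  shows "velocity A J' (restrict \<gamma> J') t = velocity A J \<gamma> t"
proof
  have "nondegenerate J" using assms unfolding nondegenerate_def by blast
  show "velocity A J' (restrict \<gamma> J') t chart = velocity A J \<gamma> t chart" for chart
  proof (cases chart)
    case U: (Pair U \<phi>)
    show ?thesis
    proof (cases "chart \<in> A \<and> \<gamma> t \<in> U")
      case True
      have "(\<phi> \<circ> restrict \<gamma> J' has_vector_derivative velocity A J \<gamma> t (U, \<phi>)) (at t within J')"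
        by (rule has_vector_derivative_transform[OF _ _ has_vector_derivative_within_subset[
              OF C1_path_has_velocity]]) (use assms U True \<open>nondegenerate J\<close> in auto)
      then show ?thesis
        unfolding U using True assms U by (intro velocity_eqI) auto
    next
      case False
      then show ?thesis using assms U by (auto simp: velocity_def)
    qed
  qed
qed

text \<open>The quadratic term keeps the path injective when \<open>v = 0\<close>.\<close>

lemma injective_path_with_velocity:
  fixes A :: "('m :: t2_space, 'k :: {real_normed_field, euclidean_space}, 'n :: finite) chart set"
  assumes A: "C1_manifold A" and U: "(U, \<phi>) \<in> A" "x \<in> U"
  obtains J \<gamma> s where "C1_path A J \<gamma>" "nondegenerate J" "s \<in> J" "inj_on \<gamma> J" "\<gamma> s = x"
    "velocity A J \<gamma> s (U, \<phi>) = v"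
proof -
  define u :: "'k ^ 'n" where "u = (if v = 0 then axis undefined 1 else 0)"
  define c where "c t = \<phi> x + t *\<^sub>R v + t\<^sup>2 *\<^sub>R u" for t
  define c' where "c' t = v + (2 * t) *\<^sub>R u" for t
  have "open (c -` (\<phi> ` U))"
    unfolding c_def by (intro open_vimage C1_manifold_chart[OF A U(1)] continuous_intros)
  moreover have "0 \<in> c -` (\<phi> ` U)" using U by (simp add: c_def)
  ultimately obtain \<epsilon> where \<epsilon>: "0 < \<epsilon>" "cball 0 \<epsilon> \<subseteq> c -` (\<phi> ` U)"
    by (meson open_contains_cball)
  \<comment> \<open>The interval starts at 0 since the quadratic term is injective only in one time
    direction.\<close>
  define J where "J = {0..\<epsilon>}"
  have "0 \<in> J" "\<epsilon> \<in> J" "0 \<noteq> \<epsilon>" using \<epsilon>(1) by (auto simp: J_def)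
  then have J: "is_interval J" "nondegenerate J" "0 \<in> J"
    unfolding nondegenerate_def J_def by (blast intro: is_interval_cc)+
  have der: "\<forall>t\<in>J. (c has_vector_derivative c' t) (at t within J)"
    unfolding c_def c'_def by (auto intro!: derivative_eq_intros simp: algebra_simps)
  have cont: "continuous_on J c'" unfolding c'_def by (intro continuous_intros)
  have "J \<subseteq> cball 0 \<epsilon>" by (auto simp: J_def)
  then have cU: "c ` J \<subseteq> \<phi> ` U" using \<epsilon>(2) by blast
  define \<gamma> where "\<gamma> = restrict (inv_into U \<phi> \<circ> c) J"
  note \<gamma> = chart_curve[OF A U(1) J(1,2) der cont cU, folded \<gamma>_def]
  show thesis
  proof
    show "C1_path A J \<gamma>" "nondegenerate J" "0 \<in> J" by (rule \<gamma> J)+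
    show "\<gamma> 0 = x" using J U inv_into_chart[OF A U] by (simp add: \<gamma>_def c_def)
    show "velocity A J \<gamma> 0 (U, \<phi>) = v" using \<gamma>(4)[OF J(3)] by (simp add: c'_def)
    have "inj_on c J"
    proof (rule inj_onI)
      fix s t assume "s \<in> J" "t \<in> J" "c s = c t"
      then have *: "0 \<le> s" "0 \<le> t" "s *\<^sub>R v + s\<^sup>2 *\<^sub>R u = t *\<^sub>R v + t\<^sup>2 *\<^sub>R u"
        by (auto simp: J_def c_def)
      show "s = t"
      proof (cases "v = 0")
        case True
        then have "u \<noteq> 0" by (simp add: u_def axis_eq_0_iff)
        with True * show ?thesis by (simp add: power2_eq_iff_nonneg)
      qed (use * in \<open>simp add: u_def\<close>)
    qed
    then have "inj_on (\<phi> \<circ> \<gamma>) J"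
      unfolding inj_on_def by (simp add: \<gamma>(3))
    then show "inj_on \<gamma> J"
      by (rule inj_on_imageI2)
  qed
qed

section \<open>Transport along horizontal lifts\<close>

lemma horizontal_lift_restrict:
  assumes g: "horizontal_lift B \<pi> \<Delta> J \<gamma> g" and J': "is_interval J'" "J' \<noteq> {}" "J' \<subseteq> J"
  shows "horizontal_lift B \<pi> \<Delta> J' (restrict \<gamma> J') (restrict g J')"
  unfolding horizontal_lift_def
proof (intro conjI impI ballI)
  have path: "C1_path B J g" using g by (simp add: horizontal_lift_def)
  then show "C1_path B J' (restrict g J')" using J' by (rule C1_path_restrict)
  show "\<pi> (restrict g J' t) = restrict \<gamma> J' t" if "t \<in> J'" for t
    using g J' that by (auto simp: horizontal_lift_def)
  show "velocity B J' (restrict g J') t \<in> \<Delta> (restrict g J' t)" if "nondegenerate J'" "t \<in> J'" for t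
  proof -
    have "nondegenerate J" using that J' unfolding nondegenerate_def by blast
    then show ?thesis
      using velocity_restrict[OF path J'(1) that(1) J'(3) that(2)] g J' that
      by (auto simp: horizontal_lift_def)
  qed
qed

lemma connection_lift:
  assumes "connection A B \<pi> \<Delta>" "C1_path A J \<gamma>" "s \<in> J" "\<pi> p = \<gamma> s"
  shows "\<exists>!g. horizontal_lift B \<pi> \<Delta> J \<gamma> g \<and> g s = p"
proof -
  have "p \<in> \<pi> -` {\<gamma> s}" using assms by simp
  then show ?thesis using assms unfolding connection_def by blast
qed

lemma connection_lift_exists:
  assumes "connection A B \<pi> \<Delta>" "C1_path A J \<gamma>" "s \<in> J" "\<pi> p = \<gamma> s"
  obtains g where "horizontal_lift B \<pi> \<Delta> J \<gamma> g" "g s = p"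
  using connection_lift[OF assms] by blast

lemma connection_lift_unique:
  assumes "connection A B \<pi> \<Delta>" "C1_path A J \<gamma>" "s \<in> J"
    and g: "horizontal_lift B \<pi> \<Delta> J \<gamma> g" "horizontal_lift B \<pi> \<Delta> J \<gamma> g'" "g s = g' s"
  shows "g = g'"
proof -
  have "\<pi> (g s) = \<gamma> s" using g assms(3) by (auto simp: horizontal_lift_def)
  from connection_lift[OF assms(1-3) this] obtain h
    where h: "\<And>h'. horizontal_lift B \<pi> \<Delta> J \<gamma> h' \<and> h' s = g s \<Longrightarrow> h' = h"
    by (rule ex1E) blast
  have "g = h" "g' = h" using g by (simp_all add: h)
  then show ?thesis by simp
qed

text \<open>The restriction of \<open>g\<close> is a horizontal lift of the restricted path, and by
  uniqueness the only one starting at \<open>g s\<close>; hence it is the lift picked by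
  \<open>THE\<close>.\<close>

lemma parallel_transport_along_lift:
  assumes \<Delta>: "connection A B \<pi> \<Delta>" and \<gamma>: "C1_path A J \<gamma>" "s \<in> J" "t \<in> J" "s \<le> t"
    and g: "horizontal_lift B \<pi> \<Delta> J \<gamma> g"
  shows "parallel_transport B \<pi> \<Delta> s t (restrict \<gamma> {s..t}) (g s) = g t"
proof -
  have sub: "{s..t} \<subseteq> J"
    using interval_subset_is_interval[OF C1_path_interval(1)[OF \<gamma>(1)], of s t] \<gamma>(2,3) by simp
  have path: "C1_path A {s..t} (restrict \<gamma> {s..t})"
    using \<gamma>(4) by (intro C1_path_restrict[OF \<gamma>(1)] is_interval_cc sub) simp
  have lift: "horizontal_lift B \<pi> \<Delta> {s..t} (restrict \<gamma> {s..t}) (restrict g {s..t})"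
    using \<gamma>(4) by (intro horizontal_lift_restrict[OF g] is_interval_cc sub) simp
  have "(THE h. horizontal_lift B \<pi> \<Delta> {s..t} (restrict \<gamma> {s..t}) h \<and> h s = g s) = restrict g {s..t}"
  proof (rule the_equality)
    show "horizontal_lift B \<pi> \<Delta> {s..t} (restrict \<gamma> {s..t}) (restrict g {s..t}) \<and>
        restrict g {s..t} s = g s"
      using lift \<gamma>(4) by simp
    show "h = restrict g {s..t}"
      if "horizontal_lift B \<pi> \<Delta> {s..t} (restrict \<gamma> {s..t}) h \<and> h s = g s" for h
      using that \<gamma>(4) by (intro connection_lift_unique[OF \<Delta> path _ _ lift, of s]) auto
  qed
  then show ?thesis
    using \<gamma>(4) by (simp add: parallel_transport_def)
qed

text \<open>Transport follows a horizontal lift in both time directions. Backwards it is an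
  \<open>inv_into\<close>, which returns \<open>g t\<close> once forward transport is known to be
  injective on the fibre.\<close>

lemma assigned_transport_along_lift:
  assumes \<Delta>: "connection A B \<pi> \<Delta>" and \<gamma>: "C1_path A J \<gamma>" "s \<in> J" "t \<in> J"
    and g: "horizontal_lift B \<pi> \<Delta> J \<gamma> g"
  shows "assigned_transport B \<pi> \<Delta> J \<gamma> s t (g s) = g t"
proof (cases "s \<le> t")
  case True
  then show ?thesis
    using parallel_transport_along_lift[OF \<Delta> \<gamma> _ g] by (simp add: assigned_transport_def)
next
  case False
  then have ts: "t \<le> s" by simp
  let ?P = "parallel_transport B \<pi> \<Delta> t s (restrict \<gamma> {t..s})"
  note P = parallel_transport_along_lift[OF \<Delta> \<gamma>(1,3,2) ts]
  \<comment> \<open>Two points with the same image have lifts over all of \<open>J\<close> that meet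
    at time \<open>s\<close>; these coincide, hence so do their values at \<open>t\<close>.\<close>
  have "inj_on ?P (\<pi> -` {\<gamma> t})"
  proof (rule inj_onI)
    fix p q assume "p \<in> \<pi> -` {\<gamma> t}" "q \<in> \<pi> -` {\<gamma> t}" and eq: "?P p = ?P q"
    then have fib: "\<pi> p = \<gamma> t" "\<pi> q = \<gamma> t" by auto
    obtain g1 where g1: "horizontal_lift B \<pi> \<Delta> J \<gamma> g1" "g1 t = p"
      using connection_lift_exists[OF \<Delta> \<gamma>(1,3) fib(1)] by blast
    obtain g2 where g2: "horizontal_lift B \<pi> \<Delta> J \<gamma> g2" "g2 t = q"
      using connection_lift_exists[OF \<Delta> \<gamma>(1,3) fib(2)] by blast
    have "g1 s = g2 s"
      using P[OF g1(1)] P[OF g2(1)] eq g1(2) g2(2) by simp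
    then have "g1 = g2"
      by (rule connection_lift_unique[OF \<Delta> \<gamma>(1,2) g1(1) g2(1)])
    then show "p = q" using g1(2) g2(2) by simp
  qed
  moreover have "g t \<in> \<pi> -` {\<gamma> t}" using g \<gamma>(3) by (auto simp: horizontal_lift_def)
  ultimately have "inv_into (\<pi> -` {\<gamma> t}) ?P (g s) = g t"
    using P[OF g] by (rule inv_into_f_eq)
  then show ?thesis using False by (simp add: assigned_transport_def)
qed

section \<open>The distribution of lift velocities\<close>

locale bundle_transport =
  fixes A :: "('m :: t2_space, 'k :: {real_normed_field, euclidean_space}, 'n :: finite) chart set"
    and B :: "('e :: t2_space, 'k, 'n + 'r :: finite) chart set"
    and \<pi> :: "'e \<Rightarrow> 'm"
    and I :: "('m, 'e) ptransport"
  assumes C1_bundle: "C1_bundle A B \<pi>"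
    and transport: "parallel_transport_along_paths A B \<pi> I"
begin

lemma shows base: "C1_manifold A" and total: "C1_manifold B" and proj: "C1_map B A \<pi>"
  using C1_bundle by (simp_all add: C1_bundle_def)

abbreviation lift where "lift \<equiv> transport_lift I"

lemma lift_apply: "t \<in> J \<Longrightarrow> lift J \<gamma> s p t = I J \<gamma> s t p"
  by (simp add: transport_lift_def)

text \<open>\<open>lift_shift\<close> is the composition law of transports: a lift restarted at one
  of its own points is unchanged. The axioms describe velocities at the starting time, and this
  carries them to all times.\<close>

lemma
  assumes "C1_path A J \<gamma>" "s \<in> J" "\<pi> p = \<gamma> s"
  shows lift_path: "C1_path B J (lift J \<gamma> s p)"
    and lift_start: "lift J \<gamma> s p s = p"
    and lift_over: "t \<in> J \<Longrightarrow> \<pi> (lift J \<gamma> s p t) = \<gamma> t"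
    and lift_shift: "t \<in> J \<Longrightarrow> lift J \<gamma> t (lift J \<gamma> s p t) = lift J \<gamma> s p"
proof -
  have T: "transport_along_paths A \<pi> I"
    using transport by (simp add: parallel_transport_along_paths_def)
  have p: "p \<in> \<pi> -` {\<gamma> s}" using assms by simp
  show "C1_path B J (lift J \<gamma> s p)"
    by (rule transport[unfolded parallel_transport_along_paths_def, THEN conjunct2, THEN conjunct1,
          rule_format, OF assms(1,2) p])
  note T = T[unfolded transport_along_paths_def, THEN spec, THEN spec, THEN mp, OF assms(1)]
  show "lift J \<gamma> s p s = p"
    unfolding lift_apply[OF assms(2)] using T assms(2) p by blast
  show "\<pi> (lift J \<gamma> s p t) = \<gamma> t" if "t \<in> J"
  proof -
    have "I J \<gamma> s t p \<in> \<pi> -` {\<gamma> t}"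
      using T assms(2) p that by blast
    then show ?thesis by (simp add: lift_apply that)
  qed
  show "lift J \<gamma> t (lift J \<gamma> s p t) = lift J \<gamma> s p" if "t \<in> J"
  proof -
    have "I J \<gamma> t u (I J \<gamma> s t p) = I J \<gamma> s u p" if "u \<in> J" for u
      using T assms(2) p that \<open>t \<in> J\<close> by blast
    then show ?thesis
      unfolding lift_apply[OF that] unfolding transport_lift_def by (rule restrict_ext)
  qed
qed

lemma lift_velocity_cong:
  assumes "C1_path A J1 \<gamma>1" "nondegenerate J1" "s1 \<in> J1" "C1_path A J2 \<gamma>2" "nondegenerate J2" "s2 \<in> J2"
    and "\<pi> p = \<gamma>1 s1" "\<pi> p = \<gamma>2 s2" "velocity A J1 \<gamma>1 s1 = velocity A J2 \<gamma>2 s2"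
  shows "velocity B J1 (lift J1 \<gamma>1 s1 p) s1 = velocity B J2 (lift J2 \<gamma>2 s2 p) s2"
proof -
  have "p \<in> \<pi> -` {\<gamma>1 s1}" "\<gamma>1 s1 = \<gamma>2 s2" using assms by auto
  then show ?thesis
    using transport[unfolded parallel_transport_along_paths_def, THEN conjunct2, THEN conjunct2,
        THEN conjunct1, THEN spec, THEN spec, THEN spec, THEN spec, THEN spec, THEN spec,
        of J1 \<gamma>1 s1 J2 \<gamma>2 s2] assms(1-6,9) by blast
qed

text \<open>The axiom supplies one path serving the whole fibre; here it is evaluated at the single
  point \<open>p\<close>.\<close>

lemma lift_velocity_combination:
  assumes "C1_path A J1 \<gamma>1" "nondegenerate J1" "s1 \<in> J1" "C1_path A J2 \<gamma>2" "nondegenerate J2" "s2 \<in> J2"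
    and "\<pi> p = \<gamma>1 s1" "\<pi> p = \<gamma>2 s2"
  obtains J \<gamma> s where "C1_path A J \<gamma>" "nondegenerate J" "s \<in> J" "\<gamma> s = \<pi> p"
    "velocity B J (lift J \<gamma> s p) s =
      tscale a1 (velocity B J1 (lift J1 \<gamma>1 s1 p) s1) + tscale a2 (velocity B J2 (lift J2 \<gamma>2 s2 p) s2)"
proof -
  have eq: "\<gamma>1 s1 = \<gamma>2 s2" using assms by auto
  have "\<exists>J3 \<gamma>3 s3. C1_path A J3 \<gamma>3 \<and> nondegenerate J3 \<and> s3 \<in> J3 \<and> \<gamma>3 s3 = \<gamma>1 s1 \<and>
           (\<forall>p \<in> \<pi> -` {\<gamma>3 s3}. velocity B J3 (lift J3 \<gamma>3 s3 p) s3 =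
              tscale a1 (velocity B J1 (lift J1 \<gamma>1 s1 p) s1) +
              tscale a2 (velocity B J2 (lift J2 \<gamma>2 s2 p) s2))"
    using transport[unfolded parallel_transport_along_paths_def, THEN conjunct2, THEN conjunct2,
        THEN conjunct2, THEN spec, THEN spec, THEN spec, THEN spec, THEN spec, THEN spec,
        of J1 \<gamma>1 s1 J2 \<gamma>2 s2] assms(1-6) eq by blast
  then obtain J \<gamma> s where 1: "C1_path A J \<gamma>" "nondegenerate J" "s \<in> J" "\<gamma> s = \<gamma>1 s1"
    and 2: "\<forall>p \<in> \<pi> -` {\<gamma> s}. velocity B J (lift J \<gamma> s p) s =
              tscale a1 (velocity B J1 (lift J1 \<gamma>1 s1 p) s1) +
              tscale a2 (velocity B J2 (lift J2 \<gamma>2 s2 p) s2)"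
    by blast
  have "p \<in> \<pi> -` {\<gamma> s}" using 1 assms by simp
  show thesis
    by (rule that[OF 1(1-3) _ bspec[OF 2 \<open>p \<in> \<pi> -` {\<gamma> s}\<close>]]) (simp add: 1 assms)
qed

abbreviation \<Delta>\<^sub>I where "\<Delta>\<^sub>I \<equiv> generated_connection A B \<pi> I"

lemma generated_connection_cases:
  assumes "h \<in> \<Delta>\<^sub>I p"
  obtains J \<gamma> s where "C1_path A J \<gamma>" "nondegenerate J" "s \<in> J" "\<pi> p = \<gamma> s"
    "h = velocity B J (lift J \<gamma> s p) s"
  using assms unfolding generated_connection_def by force

end

section \<open>The differential of the projection at one point, in fixed charts\<close>

locale bundle_transport_at = bundle_transport A B \<pi> I
  for A :: "('m :: t2_space, 'k :: {real_normed_field, euclidean_space}, 'n :: finite) chart set"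
    and B :: "('e :: t2_space, 'k, 'n + 'r :: finite) chart set" and \<pi> I +
  fixes p U \<phi> V \<psi>
  assumes U: "(U, \<phi>) \<in> A" "\<pi> p \<in> U" and V: "(V, \<psi>) \<in> B" "p \<in> V"
begin

text \<open>On \<open>tspace B p\<close> this is the differential of \<open>\<pi>\<close> at
  \<open>p\<close>, with values read in the chart \<open>\<phi>\<close>. Taking all families of
  chart entries as domain makes it a linear map between full vector spaces.\<close>

definition dproj :: "('e, 'k, 'n + 'r) tvec \<Rightarrow> 'k ^ 'n" where
  "dproj \<xi> = frechet_derivative (\<phi> \<circ> \<pi> \<circ> inv_into V \<psi>) (at (\<psi> p)) (\<xi> (V, \<psi>))"

lemma point_in_domain: "\<psi> p \<in> \<psi> ` (V \<inter> \<pi> -` U)"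
  using U V by blast

lemma linear_dproj: "Vector_Spaces.linear tscale (*s) dproj"
proof -
  let ?D = "frechet_derivative (\<phi> \<circ> \<pi> \<circ> inv_into V \<psi>) (at (\<psi> p))"
  have "Vector_Spaces.linear (*s) (*s) ?D"
    by (rule C1_on_derivative(2)[OF C1_map_chart[OF proj V(1) U(1)] point_in_domain])
  from vec.linear_add[OF this] vec.linear_scale[OF this] show ?thesis
    unfolding dproj_def by unfold_locales (simp_all add: tscale_def)
qed

sublocale dproj: Vector_Spaces.linear tscale "(*s)" dproj
  by (rule linear_dproj)

lemma dproj_velocity:
  assumes "C1_path B J g" "nondegenerate J" "t \<in> J" "g t = p" "\<And>s. s \<in> J \<Longrightarrow> \<gamma> s = \<pi> (g s)"
  shows "dproj (velocity B J g t) = velocity A J \<gamma> t (U, \<phi>)"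
  using velocity_C1_map[OF total proj assms(1-3,5), where U = V and \<phi> = \<psi> and V = U and \<psi> = \<phi>] U V assms
  by (simp add: dproj_def)

lemma dproj_lift:
  assumes "C1_path A J \<gamma>" "nondegenerate J" "s \<in> J" "\<pi> p = \<gamma> s"
  shows "dproj (velocity B J (lift J \<gamma> s p) s) = velocity A J \<gamma> s (U, \<phi>)"
  using assms by (intro dproj_velocity lift_path lift_start) (simp_all add: lift_over)

text \<open>The path given here may fail to be injective. It is replaced by an injective one with
  the same velocity, whose lift has the same velocity by the axiom on equal velocities.\<close>

lemma lift_velocity_in_generated:
  assumes \<gamma>: "C1_path A J \<gamma>" "nondegenerate J" "s \<in> J" "\<pi> p = \<gamma> s"
  shows "velocity B J (lift J \<gamma> s p) s \<in> \<Delta>\<^sub>I p"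
proof -
  obtain J' \<gamma>' s' where \<gamma>': "C1_path A J' \<gamma>'" "nondegenerate J'" "s' \<in> J'" "inj_on \<gamma>' J'"
    "\<gamma>' s' = \<pi> p" "velocity A J' \<gamma>' s' (U, \<phi>) = velocity A J \<gamma> s (U, \<phi>)"
    by (rule injective_path_with_velocity[OF base U])
  have "velocity A J' \<gamma>' s' = velocity A J \<gamma> s"
    by (rule velocity_eq_chartI[OF base \<gamma>'(1-3) \<gamma>(1-3) \<gamma>'(5) \<gamma>(4)[symmetric] U \<gamma>'(6)])
  then have "velocity B J (lift J \<gamma> s p) s = velocity B J' (lift J' \<gamma>' s' p) s'"
    using \<gamma> \<gamma>' by (intro lift_velocity_cong) simp_all
  then show ?thesis
    unfolding generated_connection_def using \<gamma>' by blast
qed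

lemma generated_in_tspace: "\<Delta>\<^sub>I p \<subseteq> tspace B p"
proof
  fix h assume "h \<in> \<Delta>\<^sub>I p"
  then obtain J \<gamma> s where \<gamma>: "C1_path A J \<gamma>" "nondegenerate J" "s \<in> J" "\<pi> p = \<gamma> s"
    "h = velocity B J (lift J \<gamma> s p) s"
    by (rule generated_connection_cases)
  show "h \<in> tspace B p"
    using velocity_in_tspace[OF total lift_path[OF \<gamma>(1,3,4)] \<gamma>(2,3)] lift_start[OF \<gamma>(1,3,4)] \<gamma>(5)
    by simp
qed

text \<open>Every coordinate vector is the velocity of an injective path through
  \<open>\<pi> p\<close>, and \<open>dproj\<close> returns it from the velocity of the lift.\<close>

lemma dproj_generated_onto:
  obtains h where "h \<in> \<Delta>\<^sub>I p" "dproj h = v"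
proof -
  obtain J \<gamma> s where \<gamma>: "C1_path A J \<gamma>" "nondegenerate J" "s \<in> J" "\<gamma> s = \<pi> p"
    "velocity A J \<gamma> s (U, \<phi>) = v"
    by (rule injective_path_with_velocity[OF base U])
  then show thesis
    using that[OF lift_velocity_in_generated[OF \<gamma>(1-3)]] dproj_lift[OF \<gamma>(1-3)] by simp
qed

text \<open>The path provided by the axiom on linear combinations is not known to be injective;
  \<open>lift_velocity_in_generated\<close> takes care of that.\<close>

lemma generated_combination:
  assumes "h1 \<in> \<Delta>\<^sub>I p" "h2 \<in> \<Delta>\<^sub>I p"
  shows "tscale a1 h1 + tscale a2 h2 \<in> \<Delta>\<^sub>I p"
proof -
  obtain J1 \<gamma>1 s1 where 1: "C1_path A J1 \<gamma>1" "nondegenerate J1" "s1 \<in> J1" "\<pi> p = \<gamma>1 s1"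
    "h1 = velocity B J1 (lift J1 \<gamma>1 s1 p) s1"
    using assms(1) by (rule generated_connection_cases)
  obtain J2 \<gamma>2 s2 where 2: "C1_path A J2 \<gamma>2" "nondegenerate J2" "s2 \<in> J2" "\<pi> p = \<gamma>2 s2"
    "h2 = velocity B J2 (lift J2 \<gamma>2 s2 p) s2"
    using assms(2) by (rule generated_connection_cases)
  obtain J \<gamma> s where "C1_path A J \<gamma>" "nondegenerate J" "s \<in> J" "\<gamma> s = \<pi> p"
    "velocity B J (lift J \<gamma> s p) s = tscale a1 h1 + tscale a2 h2"
    unfolding 1(5) 2(5) by (rule lift_velocity_combination[OF 1(1-3) 2(1-3) 1(4) 2(4)])
  then show ?thesis using lift_velocity_in_generated by metis
qed

lemma subspace_generated: "tvs.subspace (\<Delta>\<^sub>I p)"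
  unfolding tvs.subspace_def
proof (intro conjI ballI allI)
  obtain h where "h \<in> \<Delta>\<^sub>I p" by (rule dproj_generated_onto)
  then show "0 \<in> \<Delta>\<^sub>I p" using generated_combination[of h h 0 0] by simp
  show "x + y \<in> \<Delta>\<^sub>I p" if "x \<in> \<Delta>\<^sub>I p" "y \<in> \<Delta>\<^sub>I p" for x y
    using generated_combination[OF that, of 1 1] by simp
  show "tscale a x \<in> \<Delta>\<^sub>I p" if "x \<in> \<Delta>\<^sub>I p" for a x
    using generated_combination[OF that that, of a 0] by simp
qed

text \<open>
  Some path through \<open>\<pi> p\<close> has a lift with velocity \<open>0\<close>, by the axiom on linear combinations; its own velocity
  vanishes too, so by the axiom on equal velocities every path of velocity \<open>0\<close> lifts to velocity \<open>0\<close>.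
\<close>

lemma generated_dproj_eq_0:
  assumes h: "h \<in> \<Delta>\<^sub>I p" "dproj h = 0"
  shows "h = 0"
proof -
  obtain J \<gamma> s where \<gamma>: "C1_path A J \<gamma>" "nondegenerate J" "s \<in> J" "\<pi> p = \<gamma> s"
    "h = velocity B J (lift J \<gamma> s p) s"
    using h(1) by (rule generated_connection_cases)
  have "0 \<in> \<Delta>\<^sub>I p" using subspace_generated by (rule tvs.subspace_0)
  then obtain J' \<gamma>' s' where \<gamma>': "C1_path A J' \<gamma>'" "nondegenerate J'" "s' \<in> J'" "\<pi> p = \<gamma>' s'"
    "0 = velocity B J' (lift J' \<gamma>' s' p) s'"
    by (rule generated_connection_cases)
  have "velocity A J \<gamma> s (U, \<phi>) = velocity A J' \<gamma>' s' (U, \<phi>)"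
    using dproj_lift[OF \<gamma>(1-4)] dproj_lift[OF \<gamma>'(1-4)] h(2) \<gamma>(5) \<gamma>'(5) dproj.zero by metis
  then have "velocity A J \<gamma> s = velocity A J' \<gamma>' s'"
    by (rule velocity_eq_chartI[OF base \<gamma>(1-3) \<gamma>'(1-3) \<gamma>(4)[symmetric] \<gamma>'(4)[symmetric] U])
  then have "h = velocity B J' (lift J' \<gamma>' s' p) s'"
    unfolding \<gamma>(5) by (rule lift_velocity_cong[OF \<gamma>(1-3) \<gamma>'(1-3) \<gamma>(4) \<gamma>'(4)])
  then show ?thesis using \<gamma>'(5) by simp
qed

text \<open>\<open>dproj\<close> is injective and onto when restricted to the generated space, so it
  carries a basis of that space to a basis of the model space of the base.\<close>

lemma dim_generated: "tvs.dim (\<Delta>\<^sub>I p) = CARD('n)"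
proof -
  obtain b where b: "b \<subseteq> \<Delta>\<^sub>I p" "tvs.independent b" "\<Delta>\<^sub>I p \<subseteq> tvs.span b" "card b = tvs.dim (\<Delta>\<^sub>I p)"
    by (rule tvs.basis_exists)
  then have span: "tvs.span b = \<Delta>\<^sub>I p"
    using subspace_generated tvs.span_minimal by blast
  have inj: "inj_on dproj (tvs.span b)"
    unfolding span
  proof (rule inj_onI)
    fix x y assume "x \<in> \<Delta>\<^sub>I p" "y \<in> \<Delta>\<^sub>I p" "dproj x = dproj y"
    then have "x - y = 0"
      by (intro generated_dproj_eq_0 tvs.subspace_diff[OF subspace_generated]) (simp_all add: dproj.diff)
    then show "x = y" by simp
  qed
  have "vec.span (dproj ` b) = UNIV"
    unfolding dproj.span_image span using dproj_generated_onto by (metis UNIV_eq_I image_eqI)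
  then have "vec.dim (UNIV :: ('k ^ 'n) set) = card (dproj ` b)"
    using dproj.independent_injective_image[OF b(2) inj] by (intro vec.dim_eq_card) simp_all
  also have "\<dots> = card b"
    by (intro card_image inj_on_subset[OF inj] tvs.span_superset)
  finally show ?thesis using b(4) by (simp only: vec_dim_card)
qed

text \<open>Left to right, a path in the fibre projects to a constant path. Right to left,
  \<open>level_set_curve\<close> for the coordinate expression of \<open>\<pi>\<close> gives a curve
  with the prescribed velocity, and the chart \<open>\<psi>\<close> brings it back into the
  fibre.\<close>

lemma vertical_iff:
  "\<xi> \<in> vertical B \<pi> p \<longleftrightarrow> \<xi> \<in> tspace B p \<and> dproj \<xi> = 0"
proof
  assume "\<xi> \<in> vertical B \<pi> p"
  then obtain J g s where g: "C1_path B J g" "nondegenerate J" "s \<in> J" "g s = p"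
    "\<And>t. t \<in> J \<Longrightarrow> \<pi> (g t) = \<pi> p" "\<xi> = velocity B J g s"
    unfolding vertical_def by blast
  \<comment> \<open>This constant function is not \<open>undefined\<close> outside \<open>J\<close>,
    but \<open>velocity\<close> and \<open>dproj_velocity\<close> only look at it on
    \<open>J\<close>.\<close>
  have "velocity A J (\<lambda>_. \<pi> p) s (U, \<phi>) = 0"
    by (rule velocity_eqI[OF C1_path_interval(1)[OF g(1)] g(2,3) U]) (simp add: comp_def)
  moreover have "dproj \<xi> = velocity A J (\<lambda>_. \<pi> p) s (U, \<phi>)"
    unfolding g(6) using g(5) by (intro dproj_velocity g) simp
  ultimately show "\<xi> \<in> tspace B p \<and> dproj \<xi> = 0"
    using velocity_in_tspace[OF total g(1-3)] g(4,6) by simp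
next
  assume \<xi>: "\<xi> \<in> tspace B p \<and> dproj \<xi> = 0"
  let ?f = "\<phi> \<circ> \<pi> \<circ> inv_into V \<psi>" and ?S = "\<psi> ` (V \<inter> \<pi> -` U)"
  note hom = C1_manifold_chart(3)[OF total V(1)]
  \<comment> \<open>\<open>level_set_curve\<close> needs an open domain: the preimage of
    \<open>U\<close> is open by continuity of \<open>\<pi>\<close>, and the chart maps relatively
    open subsets of \<open>V\<close> to open sets.\<close>
  have "open (\<pi> -` U)"
    using proj C1_manifold_chart(1)[OF base U(1)] by (intro open_vimage) (auto simp: C1_map_def)
  then have "openin (top_of_set V) (V \<inter> \<pi> -` U)"
    by (rule openin_open_Int)
  then have "openin (top_of_set (\<psi> ` V)) ?S"
    using hom homeomorphism_imp_open_map by blast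
  then have S: "open ?S"
    using C1_manifold_chart(2)[OF total V(1)] openin_open_trans by blast
  obtain f' where f': "continuous_on ?S f'"
    and der: "\<And>x. x \<in> ?S \<Longrightarrow> (?f has_derivative blinfun_apply (f' x)) (at x)"
    using C1_map_chart[OF proj V(1) U(1)] unfolding C1_on_def by blast
  have dproj: "dproj \<eta> = f' (\<psi> p) (\<eta> (V, \<psi>))" for \<eta>
    unfolding dproj_def frechet_derivative_at[OF der[OF point_in_domain], symmetric] ..
  \<comment> \<open>The lifts given by \<open>I\<close> already exhaust all values of the
    differential, so \<open>\<pi>\<close> is a submersion at \<open>p\<close>.\<close>
  have surj: "surj (blinfun_apply (f' (\<psi> p)))"
    unfolding surj_def dproj[symmetric] by (metis dproj dproj_generated_onto)
  have "f' (\<psi> p) (\<xi> (V, \<psi>)) = 0" using \<xi> by (simp add: dproj)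
  note curve = level_set_curve[OF S point_in_domain f' der surj this]
  obtain \<epsilon> :: real and c c' where \<epsilon>: "0 < \<epsilon>" and c0: "c 0 = \<psi> p" "c' 0 = \<xi> (V, \<psi>)"
    and c': "continuous_on {0..\<epsilon>} c'"
      "\<And>t. t \<in> {0..\<epsilon>} \<Longrightarrow> (c has_vector_derivative c' t) (at t within {0..\<epsilon>})"
    and c: "\<And>t. t \<in> {0..\<epsilon>} \<Longrightarrow> c t \<in> ?S" "\<And>t. t \<in> {0..\<epsilon>} \<Longrightarrow> ?f (c t) = ?f (\<psi> p)"
    using curve by blast
  define J where "J = {0..\<epsilon>}"
  have "0 \<in> J" "\<epsilon> \<in> J" "0 \<noteq> \<epsilon>" using \<epsilon> by (auto simp: J_def)
  then have J: "is_interval J" "nondegenerate J" "0 \<in> J"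
    unfolding nondegenerate_def J_def by (blast intro: is_interval_cc)+
  have cV: "c ` J \<subseteq> \<psi> ` V" using c(1) unfolding J_def by blast
  define g where "g = restrict (inv_into V \<psi> \<circ> c) J"
  have der_c: "\<forall>t\<in>J. (c has_vector_derivative c' t) (at t within J)"
    using c'(2) unfolding J_def by blast
  note g = chart_curve[OF total V(1) J(1,2) der_c c'(1)[folded J_def] cV, folded g_def]
  have g_inv: "g t = inv_into V \<psi> (c t)" if "t \<in> J" for t using that by (simp add: g_def)
  have g0: "g 0 = p" using g_inv[OF J(3)] c0 inv_into_chart[OF total V] by simp
  have "\<pi> (g t) = \<pi> p" if t: "t \<in> J" for t
  proof -
    \<comment> \<open>The level set fixes only the coordinates of the projected curve. As the curve
      remains over \<open>U\<close>, where \<open>\<phi>\<close> is injective, its projection is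
      fixed as well.\<close>
    obtain e where e: "e \<in> V" "\<pi> e \<in> U" "c t = \<psi> e" using c(1)[of t] t unfolding J_def by blast
    have "g t = e" using g_inv[OF t] e inv_into_chart[OF total V(1) e(1)] by simp
    moreover have "\<phi> (\<pi> (g t)) = \<phi> (\<pi> p)"
      using c(2)[of t] t g_inv[OF t] inv_into_chart[OF total V] unfolding J_def by simp
    ultimately show ?thesis
      using inv_into_chart[OF base U] inv_into_chart[OF base U(1) e(2)] by metis
  qed
  moreover have "\<xi> = velocity B J g 0"
    by (rule tspace_eqI[OF _ _ V])
       (use \<xi> velocity_in_tspace[OF total g(1) J(2,3)] g0 g(4)[OF J(3)] c0 in simp_all)
  ultimately show "\<xi> \<in> vertical B \<pi> p"
    unfolding vertical_def using g(1) J g0 by blast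
qed

text \<open>Subtracting from a tangent vector the generated vector with the same
  \<open>dproj\<close> leaves a vector in the kernel, that is, a vertical one.\<close>

lemma tspace_split: "{v + h | v h. v \<in> vertical B \<pi> p \<and> h \<in> \<Delta>\<^sub>I p} = tspace B p"
proof (intro set_eqI iffI)
  fix \<xi> assume "\<xi> \<in> {v + h | v h. v \<in> vertical B \<pi> p \<and> h \<in> \<Delta>\<^sub>I p}"
  then show "\<xi> \<in> tspace B p"
    using generated_in_tspace by (auto simp: vertical_iff intro: tvs.subspace_add[OF subspace_tspace[OF total]])
next
  fix \<xi> assume \<xi>: "\<xi> \<in> tspace B p"
  obtain h where h: "h \<in> \<Delta>\<^sub>I p" "dproj h = dproj \<xi>" by (rule dproj_generated_onto)
  have "\<xi> - h \<in> tspace B p"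
    using tvs.subspace_diff[OF subspace_tspace[OF total]] \<xi> h generated_in_tspace by blast
  then have "\<xi> - h \<in> vertical B \<pi> p" using h by (simp add: vertical_iff dproj.diff)
  moreover have "\<xi> = (\<xi> - h) + h" by simp
  ultimately show "\<xi> \<in> {v + h | v h. v \<in> vertical B \<pi> p \<and> h \<in> \<Delta>\<^sub>I p}" using h(1) by blast
qed

lemma vertical_Int_generated: "vertical B \<pi> p \<inter> \<Delta>\<^sub>I p = {0}"
proof -
  have "0 \<in> tspace B p" using subspace_tspace[OF total] by (rule tvs.subspace_0)
  then show ?thesis
    using generated_dproj_eq_0 tvs.subspace_0[OF subspace_generated] by (auto simp: vertical_iff dproj.zero)
qed

end

section \<open>The generated connection and its uniqueness\<close>

context bundle_transport
begin

lemma obtain_charts_at: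
  obtains U \<phi> V \<psi> where "bundle_transport_at A B \<pi> I p U \<phi> V \<psi>"
proof -
  obtain U \<phi> where "(U, \<phi>) \<in> A" "\<pi> p \<in> U" by (rule chart_around[OF base])
  moreover obtain V \<psi> where "(V, \<psi>) \<in> B" "p \<in> V" by (rule chart_around[OF total])
  ultimately show thesis by (intro that) unfold_locales
qed

lemma horizontal_distribution_generated: "horizontal_distribution A B \<pi> \<Delta>\<^sub>I"
  unfolding horizontal_distribution_def
proof
  fix p
  obtain U \<phi> V \<psi> where "bundle_transport_at A B \<pi> I p U \<phi> V \<psi>" by (rule obtain_charts_at)
  then interpret bundle_transport_at A B \<pi> I p U \<phi> V \<psi> .
  show "tvs.subspace (\<Delta>\<^sub>I p) \<and> \<Delta>\<^sub>I p \<subseteq> tspace B p \<and> tvs.dim (\<Delta>\<^sub>I p) = CARD('n) \<and>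
     {v + h | v h. v \<in> vertical B \<pi> p \<and> h \<in> \<Delta>\<^sub>I p} = tspace B p \<and> vertical B \<pi> p \<inter> \<Delta>\<^sub>I p = {0}"
    by (intro conjI subspace_generated generated_in_tspace dim_generated tspace_split vertical_Int_generated)
qed

lemma lift_velocity_in_generated:
  assumes "C1_path A J \<gamma>" "nondegenerate J" "s \<in> J" "\<pi> p = \<gamma> s"
  shows "velocity B J (lift J \<gamma> s p) s \<in> \<Delta>\<^sub>I p"
proof -
  obtain U \<phi> V \<psi> where "bundle_transport_at A B \<pi> I p U \<phi> V \<psi>" by (rule obtain_charts_at)
  then show ?thesis using assms by (rule bundle_transport_at.lift_velocity_in_generated)
qed

text \<open>By \<open>lift_shift\<close>, the velocity at time \<open>t\<close> is that of a lift
  starting at \<open>t\<close>, to which the statement on initial velocities applies.\<close>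

lemma lift_horizontal:
  assumes \<gamma>: "C1_path A J \<gamma>" "s \<in> J" "\<pi> p = \<gamma> s"
  shows "horizontal_lift B \<pi> \<Delta>\<^sub>I J \<gamma> (lift J \<gamma> s p)"
  unfolding horizontal_lift_def
proof (intro conjI impI ballI lift_path[OF \<gamma>] lift_over[OF \<gamma>])
  fix t assume "nondegenerate J" "t \<in> J"
  then show "velocity B J (lift J \<gamma> s p) t \<in> \<Delta>\<^sub>I (lift J \<gamma> s p t)"
    using lift_velocity_in_generated[OF \<gamma>(1), of t "lift J \<gamma> s p t"] lift_over[OF \<gamma>] lift_shift[OF \<gamma>]
    by simp
qed

text \<open>Horizontal lifts exist because \<open>I\<close> provides them; that there is at most one
  is the hypothesis.\<close>

lemma connection_generated:
  assumes "lifts_determined A B \<pi> \<Delta>\<^sub>I"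
  shows "connection A B \<pi> \<Delta>\<^sub>I"
  unfolding connection_def
proof (intro conjI horizontal_distribution_generated allI impI ballI)
  fix J \<gamma> s p assume *: "C1_path A J \<gamma>" "s \<in> J" "p \<in> \<pi> -` {\<gamma> s}"
  then have "\<exists>\<^sub>\<le>\<^sub>1g. horizontal_lift B \<pi> \<Delta>\<^sub>I J \<gamma> g \<and> g s = p"
    using assms unfolding lifts_determined_def by blast
  moreover have "horizontal_lift B \<pi> \<Delta>\<^sub>I J \<gamma> (lift J \<gamma> s p) \<and> lift J \<gamma> s p s = p"
    using * by (simp add: lift_horizontal lift_start)
  ultimately show "\<exists>!g. horizontal_lift B \<pi> \<Delta>\<^sub>I J \<gamma> g \<and> g s = p"
    unfolding Uniq_def by metis
qed

lemma transports_coincide_generated: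
  assumes "connection A B \<pi> \<Delta>\<^sub>I"
  shows "transports_coincide A \<pi> (assigned_transport B \<pi> \<Delta>\<^sub>I) I"
  unfolding transports_coincide_def
proof (intro allI impI ballI)
  fix J \<gamma> s t p assume "C1_path A J \<gamma>" "s \<in> J" "t \<in> J" "p \<in> \<pi> -` {\<gamma> s}"
  then have *: "C1_path A J \<gamma>" "s \<in> J" "\<pi> p = \<gamma> s" "t \<in> J" by auto
  show "assigned_transport B \<pi> \<Delta>\<^sub>I J \<gamma> s t p = I J \<gamma> s t p"
    using assigned_transport_along_lift[OF assms *(1,2,4) lift_horizontal[OF *(1-3)]]
    by (simp add: lift_start[OF *(1-3)] lift_apply[OF *(4)])
qed

lemma generated_connection_unique:
  assumes \<Delta>: "connection A B \<pi> \<Delta>"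
    and coincide: "transports_coincide A \<pi> (assigned_transport B \<pi> \<Delta>) I"
  shows "\<Delta>\<^sub>I = \<Delta>"
proof
  fix p
  obtain U \<phi> V \<psi> where "bundle_transport_at A B \<pi> I p U \<phi> V \<psi>" by (rule obtain_charts_at)
  then interpret bundle_transport_at A B \<pi> I p U \<phi> V \<psi> .
  have subspace: "tvs.subspace (\<Delta> p)" and tspace: "\<Delta> p \<subseteq> tspace B p"
    and vertical: "vertical B \<pi> p \<inter> \<Delta> p = {0}"
    using \<Delta> by (simp_all add: connection_def horizontal_distribution_def)
  have sub: "\<Delta>\<^sub>I p \<subseteq> \<Delta> p"
  proof
    fix h assume "h \<in> \<Delta>\<^sub>I p"
    then obtain J \<gamma> s where \<gamma>: "C1_path A J \<gamma>" "nondegenerate J" "s \<in> J" "\<pi> p = \<gamma> s"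
      "h = velocity B J (lift J \<gamma> s p) s"
      by (rule generated_connection_cases)
    obtain g where g: "horizontal_lift B \<pi> \<Delta> J \<gamma> g" "g s = p"
      using \<Delta> \<gamma>(1,3,4) by (rule connection_lift_exists)
    \<comment> \<open>Both are \<open>undefined\<close> outside \<open>J\<close>, so agreement on
      \<open>J\<close> gives equal functions and thereby equal velocities.\<close>
    have "lift J \<gamma> s p = g"
    proof (rule extensionalityI)
      show "lift J \<gamma> s p \<in> extensional J" "g \<in> extensional J"
        using g(1) by (auto simp: transport_lift_def horizontal_lift_def intro: C1_path_interval)
      fix t assume t: "t \<in> J"
      have "p \<in> \<pi> -` {\<gamma> s}" using \<gamma>(4) by simp
      then have "I J \<gamma> s t p = assigned_transport B \<pi> \<Delta> J \<gamma> s t p"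
        using coincide \<gamma>(1,3) t unfolding transports_coincide_def by metis
      then show "lift J \<gamma> s p t = g t"
        using assigned_transport_along_lift[OF \<Delta> \<gamma>(1,3) t g(1)] g(2) by (simp add: lift_apply[OF t])
    qed
    then show "h \<in> \<Delta> p"
      using g \<gamma> by (auto simp: horizontal_lift_def)
  qed
  moreover have "\<Delta> p \<subseteq> \<Delta>\<^sub>I p"
  proof
    fix h assume h: "h \<in> \<Delta> p"
    obtain h' where h': "h' \<in> \<Delta>\<^sub>I p" "dproj h' = dproj h" by (rule dproj_generated_onto)
    \<comment> \<open>The difference lies in \<open>\<Delta> p\<close> by the inclusion just shown,
      and in the vertical space since \<open>dproj\<close> kills it; these spaces meet only in
      0.\<close>
    have "h - h' \<in> \<Delta> p" using h h' sub tvs.subspace_diff[OF subspace] by blast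
    moreover have "h - h' \<in> vertical B \<pi> p"
      using calculation tspace h' by (auto simp: vertical_iff dproj.diff)
    ultimately have "h - h' = 0" using vertical by blast
    then show "h \<in> \<Delta>\<^sub>I p" using h' by simp
  qed
  ultimately show "\<Delta>\<^sub>I p = \<Delta> p" by blast
qed

end

theorem theorem7p2:
  fixes A :: "('m :: t2_space, 'k :: {real_normed_field, euclidean_space}, 'n :: finite) chart set"
    and B :: "('e :: t2_space, 'k, 'n + 'r :: finite) chart set"
    and \<pi> :: "'e \<Rightarrow> 'm"
    and I :: "('m, 'e) ptransport"
  assumes "C1_bundle A B \<pi>"
    and "parallel_transport_along_paths A B \<pi> I"
    and "lifts_determined A B \<pi> (generated_connection A B \<pi> I)"
  shows "(\<exists>!\<Delta>. connection A B \<pi> \<Delta> \<and>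
            transports_coincide A \<pi> (assigned_transport B \<pi> \<Delta>) I) \<and>
         (\<forall>\<Delta>. connection A B \<pi> \<Delta> \<and>
            transports_coincide A \<pi> (assigned_transport B \<pi> \<Delta>) I \<longrightarrow>
            generated_connection A B \<pi> I = \<Delta>)"
proof -
  interpret bundle_transport A B \<pi> I
    using assms(1,2) by unfold_locales
  have "connection A B \<pi> (generated_connection A B \<pi> I)"
    using assms(3) by (rule connection_generated)
  then show ?thesis
    using transports_coincide_generated generated_connection_unique by metis
qed

end
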